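(* Let $m$ be a positive integer and $0<x<\pi$. Then $$\sum_{n=1}^\infty\frac{(-1)^{n-1}\sin nx}{n^{2m}}=\frac{(-1)^{m}\pi^{2m-1}}{(2m-1)!}\bigg(2^{2m-1}\zeta'\Big(1-2m,1-\frac x{2\pi}\Big)-2^{2m-1}\zeta'\Big(1-2m,\frac x{2\pi}\Big)-\zeta'\Big(1-2m,1-\frac x\pi\Big)+\zeta'\Big(1-2m,\frac x\pi\Big)\bigg).$$
   Context: For $0<a\le 1$, $\zeta(s,a)$ denotes the Hurwitz zeta function, defined for $\Re s>1$ by $\zeta(s,a)=\sum_{k=0}^\infty (k+a)^{-s}$ and extended by analytic continuation to all complex $s\neq 1$. Throughout, $\zeta'(s,a)$ denotes the partial derivative $\frac{\partial}{\partial s}\zeta(s,a)$ with respect to the first variable $s$. *)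

theory Defs
  imports "HOL-Complex_Analysis.Complex_Analysis"
begin

text \<open>Hurwitz zeta function zeta(s,a): the holomorphic function on the complex plane minus 1
  that agrees with the series sum over k of (k+a) to the power -s for Re s > 1
  (analytic continuation; unique by the identity theorem).\<close>
definition hurwitz_zeta :: "complex \<Rightarrow> real \<Rightarrow> complex" where
  "hurwitz_zeta s a =
     (SOME f. f holomorphic_on (- {1}) \<and>
        (\<forall>z. Re z > 1 \<longrightarrow> (\<lambda>k. (of_real (real k + a)) powr (- z)) sums f z)) s"

definition hurwitz_zeta' :: "complex \<Rightarrow> real \<Rightarrow> complex" where
  "hurwitz_zeta' s a = deriv (\<lambda>w. hurwitz_zeta w a) s"

end

(* Idea.  For Re s > 1, Gamma(s) zeta(s,a) is the Mellin transform of
   e^{-at} / (1 - e^{-t}).  Split it at t = 1.  On (0,1] the power series sum d_n t^n of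
   t e^{-at} / (1 - e^{-t}) turns the integral into sum d_n / (s + n - 1), and the integral over
   [1,oo) is entire in s; since 1/Gamma vanishes at the poles s = 1 - n with n > 0, this continues
   zeta(s,a) to s <> 1.  In the difference of the functions for a and 1 - a the coefficient d_{2m}
   cancels, so that
     zeta'(1-2m,a) - zeta'(1-2m,1-a) = (1/Gamma)'(1-2m) * M,
   with M the finite part of the integral of t^{-2m} sinh((1/2-a)t) / sinh(t/2) over (0,oo).
   Expanding the quotient in partial fractions with poles at c = 2 pi n and subtracting its Taylor
   polynomial leaves (-1)^m t^{2m} sum 4 sin(ca) / (c^{2m-1} (t^2 + c^2)), which integrates
   termwise to M = (-1)^m 2 pi sum sin(ca) / c^{2m}.  The alternating series is obtained from the
   one at x by removing twice the terms of even index, i.e. a multiple of the series at 2x. *)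

theory Submission
  imports Defs
begin

section \<open>Fourier and partial fraction expansions\<close>

text \<open>Pairing a with 1 - a is forced by the index n = 2m. At s = 1 - 2m every other
  \<open>rGamma s / (s + n - 1)\<close> has as derivative a rational multiple of rGamma'(1 - 2m),
  but for n = 2m the pole sits at that very point and the derivative rGamma''(1 - 2m) / 2 would
  bring in harmonic numbers and Euler's constant. The difference of the two kernels is even in t, so
  t times it has odd powers only and this term drops out. The finite part needs no regularisation:
  for j < m the monomial t^(2j - 2m) contributes 1 / (2j + 1 - 2m) from (0,1] after continuation and
  the negative of it from [1,oo). The Taylor polynomial cancels, and a convergent integral remains.
  The partial fractions are not obtained from residues. The series over the poles is, up to sign,
  the derivative of a cosine series that solves a Neumann problem with forcing term B_2, the second
  Bernoulli polynomial; uniqueness identifies it with a hyperbolic function. The Fourier series of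
  B_2 comes from log (1 - r e^(ix)) by Abel summation, because its termwise derivative converges
  only conditionally.\<close>

lemma summable_inverse_squares_Suc: "summable (\<lambda>n. 1 / (real (Suc n))\<^sup>2)"
  using inverse_squares_sums by (simp add: sums_iff add.commute)

section \<open>Fourier series of a quadratic polynomial by Abel summation\<close>

text \<open>Termwise differentiation gives minus the sum of r^n sin(nx) / n, the imaginary part of
  the series of Ln (1 - z) at z = r e^(ix). The damping by r < 1 supplies the geometric majorant
  that the derivative series would otherwise lack.\<close>

lemma deriv_cos_series_Abel:
  fixes r :: real
  assumes r: "0 \<le> r" "r < 1"
  shows "((\<lambda>x. \<Sum>n. r ^ Suc n * cos (real (Suc n) * x) / (real (Suc n))\<^sup>2) has_real_derivative
           Im (Ln (1 - of_real r * cis x))) (at x)"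
proof -
  have nrm: "norm (of_real r * cis x) < 1" using r by (simp add: norm_mult)
  have sm: "summable (\<lambda>n. r ^ Suc n)" using r by (simp add: summable_mult summable_geometric)
  have "((\<lambda>x. \<Sum>n. r ^ Suc n * cos (real (Suc n) * x) / (real (Suc n))\<^sup>2) has_real_derivative
      (\<Sum>n. - (r ^ Suc n * sin (real (Suc n) * x) / real (Suc n)))) (at x)"
  proof (rule has_field_derivative_series'(2)[where S=UNIV and ?x0.0=0 and x=x and
        f="\<lambda>n x. r ^ Suc n * cos (real (Suc n) * x) / (real (Suc n))\<^sup>2" and
        f'="\<lambda>n x. - (r ^ Suc n * sin (real (Suc n) * x) / real (Suc n))"])
    show "((\<lambda>x. r ^ Suc n * cos (real (Suc n) * x) / (real (Suc n))\<^sup>2) has_real_derivative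
      - (r ^ Suc n * sin (real (Suc n) * x) / real (Suc n))) (at x within UNIV)" for n x
      by (auto intro!: derivative_eq_intros simp: power2_eq_square)
    show "uniformly_convergent_on UNIV (\<lambda>n x. \<Sum>i<n. - (r ^ Suc i * sin (real (Suc i) * x) / real (Suc i)))"
    proof (rule Weierstrass_m_test'[OF _ sm])
      fix n x
      have "\<bar>sin (real (Suc n) * x)\<bar> / real (Suc n) \<le> 1 / 1"
        by (intro frac_le) auto
      then have "r ^ Suc n * (\<bar>sin (real (Suc n) * x)\<bar> / real (Suc n)) \<le> r ^ Suc n * 1"
        using r by (intro mult_left_mono) auto
      then show "norm (- (r ^ Suc n * sin (real (Suc n) * x) / real (Suc n))) \<le> r ^ Suc n"
        using r by (simp add: abs_mult)
    qed
    show "summable (\<lambda>n. r ^ Suc n * cos (real (Suc n) * 0) / (real (Suc n))\<^sup>2)"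
    proof (rule summable_comparison_test'[OF sm])
      fix n
      have "1 / (real (Suc n))\<^sup>2 \<le> 1 / 1"
        by (intro frac_le) (auto simp del: of_nat_Suc)
      then have "r ^ Suc n * (1 / (real (Suc n))\<^sup>2) \<le> r ^ Suc n * 1"
        using r by (intro mult_left_mono) auto
      then show "norm (r ^ Suc n * cos (real (Suc n) * 0) / (real (Suc n))\<^sup>2) \<le> r ^ Suc n"
        using r by simp
    qed
  qed auto
  moreover have "(\<lambda>n. - (r ^ Suc n * sin (real (Suc n) * x) / real (Suc n))) sums Im (Ln (1 - of_real r * cis x))"
  proof -
    have "(\<lambda>n. - ((of_real r * cis x) ^ n) / of_nat n) sums Ln (1 - of_real r * cis x)"
      using Ln_series'[of "- (of_real r * cis x)"] nrm by simp
    \<comment> \<open>The term at n = 0 is -1 / 0 = 0, so nothing is lost by the shift.\<close>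
    then have "(\<lambda>n. - ((of_real r * cis x) ^ Suc n) / of_nat (Suc n)) sums Ln (1 - of_real r * cis x)"
      by (subst sums_Suc_iff) simp
    from sums_Im[OF this] show ?thesis
      by (simp add: power_mult_distrib Complex.DeMoivre flip: of_real_power del: of_nat_Suc power_Suc)
  qed
  ultimately show ?thesis by (simp add: sums_iff)
qed

text \<open>1 - e^(ix) = 2 sin(x/2) e^(i(x - pi)/2) with a positive first factor and an angle inside
  the principal range. The second claim gives continuity of \<open>Ln\<close> at this point, which
  the limit r -> 1 requires.\<close>

lemma Im_Ln_one_minus_cis:
  assumes "0 < x" "x < 2 * pi"
  shows "Im (Ln (1 - cis x)) = (x - pi) / 2" and "1 - cis x \<notin> \<real>\<^sub>\<le>\<^sub>0"
proof -
  have s: "sin (x / 2) > 0" using assms by (intro sin_gt_zero) auto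
  have 1: "sin x = 2 * sin (x/2) * cos (x/2)" "cos x = 1 - 2 * (sin (x/2))\<^sup>2"
    using sin_double[of "x/2"] cos_double_sin[of "x/2"] by auto
  have "1 - cis x = of_real (2 * sin (x / 2)) * cis ((x - pi) / 2)"
    by (auto simp: complex_eq_iff 1 diff_divide_distrib cos_diff sin_diff power2_eq_square)
  then have eq: "1 - cis x = of_real (2 * sin (x / 2)) * exp (\<i> * of_real ((x - pi) / 2))"
    by (simp add: cis_conv_exp)
  have "Im (\<i> * of_real ((x - pi) / 2)) = (x - pi) / 2"
    by (simp only: Im_i_times Re_complex_of_real)
  then have "Ln (exp (\<i> * of_real ((x - pi) / 2))) = \<i> * of_real ((x - pi) / 2)"
    by (intro Ln_exp) (use assms in simp_all)
  moreover have "Im (Ln (1 - cis x)) = Im (Ln (exp (\<i> * of_real ((x - pi) / 2))))"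
    unfolding eq using s Ln_of_real[of "2 * sin (x / 2)"] by (subst Ln_times_of_real) auto
  ultimately show im: "Im (Ln (1 - cis x)) = (x - pi) / 2"
    by (simp only: Im_i_times Re_complex_of_real)
  have "1 - cis x \<noteq> 0" unfolding eq using s by simp
  moreover have "Im (Ln (1 - cis x)) \<noteq> pi" using im assms by simp
  ultimately show "1 - cis x \<notin> \<real>\<^sub>\<le>\<^sub>0"
    using Im_Ln_eq_pi[of "1 - cis x"]
    by (metis complex_nonpos_Reals_iff complex_eq_iff order_le_less zero_complex.sel)
qed

text \<open>The damped derivative is integrated over a compact part of (0, 2 pi), and r tends to 1
  by dominated convergence: an imaginary part of \<open>Ln\<close> never exceeds pi in absolute
  value. This fixes the sum up to a constant, which continuity and the Basel sum at x = 0
  determine.\<close>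

lemma sums_cos_over_squares:
  assumes "0 \<le> x" "x \<le> 2 * pi"
  shows "(\<lambda>n. cos (real (Suc n) * x) / (real (Suc n))\<^sup>2) sums (pi\<^sup>2 / 6 - pi * x / 2 + x\<^sup>2 / 4)"
proof -
  define C where "C r x = (\<Sum>n. r ^ Suc n * cos (real (Suc n) * x) / (real (Suc n))\<^sup>2)" for r x :: real
  define \<rho> where "\<rho> k = 1 - 1 / real (Suc k)" for k
  have \<rho>: "0 \<le> \<rho> k" "\<rho> k < 1" for k by (auto simp: \<rho>_def field_simps)
  have \<rho>_lim: "\<rho> \<longlonglongrightarrow> 1"
    unfolding \<rho>_def using LIMSEQ_inverse_real_of_nat
    by (auto intro!: tendsto_diff[of _ 1 _ _ 0, simplified] simp: inverse_eq_divide)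
  have bound: "norm (r ^ Suc n * cos (real (Suc n) * x) / (real (Suc n))\<^sup>2) \<le> 1 / (real (Suc n))\<^sup>2"
    if "0 \<le> r" "r \<le> 1" for r x n
  proof -
    have "r ^ Suc n * \<bar>cos (real (Suc n) * x)\<bar> \<le> 1 * 1"
      using that by (intro mult_mono power_le_one) auto
    then show ?thesis using that by (simp add: abs_mult divide_right_mono del: power_Suc)
  qed
  have ulim: "uniform_limit X (\<lambda>n p. \<Sum>i<n. fst p ^ Suc i * cos (real (Suc i) * snd p) / (real (Suc i))\<^sup>2)
      (\<lambda>p. C (fst p) (snd p)) sequentially" if "X \<subseteq> {0..1} \<times> UNIV" for X
    unfolding C_def
    using that by (intro Weierstrass_m_test[OF bound summable_inverse_squares_Suc]) auto
  \<comment> \<open>Joint continuity serves twice: along r it gives the limit r -> 1, and along x at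
    r = 1 it gives continuity up to the endpoints.\<close>
  have cont: "continuous_on ({0..1} \<times> UNIV) (\<lambda>p. C (fst p) (snd p))"
    by (rule uniform_limit_theorem[OF _ ulim]) (auto intro!: always_eventually continuous_intros)
  have contx: "continuous_on UNIV (C 1)"
    using continuous_on_compose2[OF cont, of UNIV "\<lambda>x. (1, x)"] by (simp add: continuous_intros image_subset_iff)
  have lim: "(\<lambda>k. C (\<rho> k) x) \<longlonglongrightarrow> C 1 x" for x
  proof -
    have "continuous_on {0..1} (\<lambda>r. C r x)"
      using continuous_on_compose2[OF cont, of "{0..1}" "\<lambda>r. (r, x)"] by (simp add: continuous_intros image_subset_iff)
    then show ?thesis
      using \<rho> \<rho>_lim by (auto intro!: continuous_on_tendsto_compose[of "{0..1}" "\<lambda>r. C r x"] always_eventually less_imp_le)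
  qed
  have diff: "C 1 y - C 1 x = integral {x..y} (\<lambda>u. (u - pi) / 2)" if xy: "0 < x" "x \<le> y" "y < 2 * pi" for x y
  proof -
    define f where "f k u = Im (Ln (1 - of_real (\<rho> k) * cis u))" for k u
    have int: "(f k has_integral (C (\<rho> k) y - C (\<rho> k) x)) {x..y}" for k
      unfolding f_def C_def
      using \<rho>[of k] xy deriv_cos_series_Abel[of "\<rho> k"]
      by (intro fundamental_theorem_of_calculus)
         (auto simp flip: has_real_derivative_iff_has_vector_derivative intro: has_field_derivative_at_within)
    have "(\<lambda>k. integral {x..y} (f k)) \<longlonglongrightarrow> integral {x..y} (\<lambda>u. (u - pi) / 2)"
    proof (rule dominated_convergence(2)[where h="\<lambda>_. pi"])
      show "f k integrable_on {x..y}" for k using int by blast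
      show "norm (f k u) \<le> pi" for k u
      proof -
        have "1 \<noteq> of_real (\<rho> k) * cis u"
          using \<rho>[of k] by (metis abs_of_nonneg less_irrefl mult.right_neutral norm_cis norm_mult norm_of_real norm_one)
        then have "1 - of_real (\<rho> k) * cis u \<noteq> 0" by simp
        then show ?thesis
          unfolding f_def 
            using Im_Ln_le_pi[of "1 - of_real (\<rho> k) * cis u"] mpi_less_Im_Ln[of "1 - of_real (\<rho> k) * cis u"]
            by (auto simp: abs_le_iff)
      qed
      fix u assume u: "u \<in> {x..y}"
      have "(\<lambda>k. f k u) \<longlonglongrightarrow> Im (Ln (1 - cis u))"
        unfolding f_def using Im_Ln_one_minus_cis(2)[of u] u xy \<rho>_lim
        by (auto intro!: tendsto_eq_intros)
      moreover have "Im (Ln (1 - cis u)) = (u - pi) / 2"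
        using Im_Ln_one_minus_cis(1)[of u] u xy by simp
      ultimately show "(\<lambda>k. f k u) \<longlonglongrightarrow> (u - pi) / 2" by (simp only:)
    qed auto
    moreover have "integral {x..y} (f k) = C (\<rho> k) y - C (\<rho> k) x" for k
      using int by blast
    ultimately show ?thesis
      using tendsto_diff[OF lim[of y] lim[of x]] LIMSEQ_unique by force
  qed
  \<comment> \<open>The integral formula makes \<open>\<phi>\<close> constant on the open interval
    only; the value at 0, where the sum is known, is reached through the closure.\<close>
  define \<phi> where "\<phi> x = C 1 x - (pi\<^sup>2 / 6 - pi * x / 2 + x\<^sup>2 / 4)" for x
  have \<phi>_cont: "continuous_on {0..2 * pi} \<phi>"
    unfolding \<phi>_def by (intro continuous_intros continuous_on_subset[OF contx]) auto
  have \<phi>_eq: "\<phi> x = \<phi> y" if xy: "0 < x" "x \<le> y" "y < 2 * pi" for x y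
  proof -
    have "((\<lambda>u. (u - pi) / 2) has_integral (y\<^sup>2 / 4 - pi * y / 2 - (x\<^sup>2 / 4 - pi * x / 2))) {x..y}"
      using xy by (intro fundamental_theorem_of_calculus)
        (auto simp flip: has_real_derivative_iff_has_vector_derivative intro!: derivative_eq_intros simp: field_simps)
    then have "C 1 y - C 1 x = y\<^sup>2 / 4 - pi * y / 2 - (x\<^sup>2 / 4 - pi * x / 2)"
      by (rule trans[OF diff[OF xy] integral_unique])
    then show ?thesis by (simp add: \<phi>_def)
  qed
  have open_const: "\<phi> x = \<phi> pi" if "x \<in> {0<..<2 * pi}" for x
    using \<phi>_eq[of x pi] \<phi>_eq[of pi x] that by (cases "x \<le> pi") auto
  have clo: "closure {0<..<2 * pi} = {0..2 * pi}" by (intro closure_greaterThanLessThan) simp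
  have \<phi>_const: "\<phi> x = \<phi> pi" if "x \<in> {0..2*pi}" for x
    by (rule continuous_constant_on_closure[of "{0<..<2 * pi}" \<phi> "\<phi> pi" x, unfolded clo, OF \<phi>_cont open_const that])
  have "C 1 0 = pi\<^sup>2 / 6"
    unfolding C_def using inverse_squares_sums by (simp add: sums_iff add.commute)
  then have "\<phi> 0 = 0" by (simp add: \<phi>_def)
  moreover have "\<phi> 0 = \<phi> pi" by (rule \<phi>_const) simp
  moreover have "\<phi> x = \<phi> pi" by (rule \<phi>_const) (use assms in simp)
  ultimately have "C 1 x = pi\<^sup>2 / 6 - pi * x / 2 + x\<^sup>2 / 4"
    by (simp add: \<phi>_def)
  moreover have "summable (\<lambda>n. cos (real (Suc n) * x) / (real (Suc n))\<^sup>2)"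
    using bound[of 1] by (intro summable_comparison_test'[OF summable_inverse_squares_Suc]) auto
  ultimately show ?thesis by (simp add: C_def sums_iff)
qed

section \<open>Partial fractions from a Neumann problem\<close>

text \<open>The conditions at 0 and 1 concern \<open>w'\<close> because the derivative of a cosine
  series is a sine series, which vanishes there. The two first integrals give w(1) = w(0) e^t and
  w(1) = w(0) e^(-t), hence w(0) = 0.\<close>

lemma neumann_ode_unique:
  fixes w w' :: "real \<Rightarrow> real"
  assumes t: "t > 0"
    and w: "\<And>x. x \<in> {0..1} \<Longrightarrow> (w has_real_derivative w' x) (at x within {0..1})"
    and w': "\<And>x. x \<in> {0..1} \<Longrightarrow> (w' has_real_derivative t\<^sup>2 * w x) (at x within {0..1})"
    and bc: "w' 0 = 0" "w' 1 = 0"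
    and a: "a \<in> {0..1}"
  shows "w' a = 0"
proof -
  \<comment> \<open>The operator factors as \<open>(D - t) (D + t)\<close>; \<open>\<sigma>\<close> is the sign.\<close>
  have const: "(w' x + \<sigma> * t * w x) * exp (- \<sigma> * t * x) = \<sigma> * t * w 0"
    if \<sigma>: "\<sigma> * \<sigma> = 1" and x: "x \<in> {0..1}" for x \<sigma>
  proof -
    have d: "((\<lambda>x. (w' x + \<sigma> * t * w x) * exp (- \<sigma> * t * x)) has_real_derivative 0) (at x within {0..1})"
      if "x \<in> {0..1}" for x
    proof -
      have "\<sigma> * (\<sigma> * y) = y" for y :: real using \<sigma> by (simp flip: mult.assoc)
      then show ?thesis
        by (auto intro!: derivative_eq_intros w[OF that] w'[OF that] simp: algebra_simps power2_eq_square)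
    qed
    obtain c where "\<And>x. x \<in> {0..1} \<Longrightarrow> (w' x + \<sigma> * t * w x) * exp (- \<sigma> * t * x) = c"
      using has_field_derivative_zero_constant[of "{0..1::real}", OF _ d] by auto
    from this[of x] this[of 0] x bc show ?thesis by simp
  qed
  have p: "w' x = t * w 0 * exp (t * x) - t * w x" if "x \<in> {0..1}" for x
    using const[of 1 x] that by (simp add: exp_minus field_simps)
  have m: "w' x = t * w x - t * w 0 * exp (- t * x)" if "x \<in> {0..1}" for x
    using const[of "-1" x] that by (simp add: exp_minus field_simps)
  have "t * w 1 = t * w 0 * exp t" "t * w 1 = t * w 0 * exp (- t)"
    using p[of 1] m[of 1] unfolding bc by auto
  then have "w 0 * (t * (exp t - exp (- t))) = 0" by algebra
  moreover have "exp t - exp (- t) > 0" using t by simp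
  ultimately have "w 0 = 0" using t by simp
  then show ?thesis using p[OF a] m[OF a] by simp
qed

text \<open>The quadratic is B_2(a); this is the previous series rescaled to period 1, in the form
  in which it enters the differential equation.\<close>

lemma bernoulli2_fourier:
  assumes "0 \<le> a" "a \<le> 1"
  defines "c \<equiv> \<lambda>n. 2 * pi * real (Suc n)"
  shows "(\<lambda>n. 4 * cos (c n * a) / (c n)\<^sup>2) sums (a\<^sup>2 - a + 1 / 6)"
proof -
  have "(\<lambda>n. cos (real (Suc n) * (2 * pi * a)) / (real (Suc n))\<^sup>2) sums
      (pi\<^sup>2 / 6 - pi * (2 * pi * a) / 2 + (2 * pi * a)\<^sup>2 / 4)"
    using assms by (intro sums_cos_over_squares) auto
  also have "pi\<^sup>2 / 6 - pi * (2 * pi * a) / 2 + (2 * pi * a)\<^sup>2 / 4 = pi\<^sup>2 * (a\<^sup>2 - a + 1 / 6)"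
    by (simp add: algebra_simps power2_eq_square)
  finally have "(\<lambda>n. 1 / pi\<^sup>2 * (cos (real (Suc n) * (2 * pi * a)) / (real (Suc n))\<^sup>2)) sums
      (1 / pi\<^sup>2 * (pi\<^sup>2 * (a\<^sup>2 - a + 1 / 6)))"
    by (rule sums_mult)
  then show ?thesis
    by (simp add: c_def mult_ac power2_eq_square del: of_nat_Suc)
qed

text \<open>Crude consequences of pi >= 2 that make 1/n^2 a common majorant for all series over the
  poles.\<close>

lemma two_pi_Suc_bounds:
  fixes n :: nat
  defines "c \<equiv> 2 * pi * real (Suc n)"
  shows "1 \<le> c" and "4 / c\<^sup>2 \<le> 1 / (real (Suc n))\<^sup>2"
proof -
  have "1 * 1 \<le> (2 * pi) * real (Suc n)" using pi_ge_two by (intro mult_mono) auto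
  then show "1 \<le> c" by (simp add: c_def)
  have "(2 * real (Suc n))\<^sup>2 \<le> c\<^sup>2"
    unfolding c_def using pi_ge_two by (intro power_mono mult_right_mono) auto
  then have "4 / c\<^sup>2 \<le> 4 / (2 * real (Suc n))\<^sup>2" by (intro divide_left_mono) (auto simp: c_def)
  then show "4 / c\<^sup>2 \<le> 1 / (real (Suc n))\<^sup>2" by (simp add: power_mult_distrib del: of_nat_Suc)
qed

text \<open>\<open>1 - 2 * a\<close> is the limit of the quotient as t tends to 0. Removing it and
  dividing by t^2 turns terms of order 1/n into terms of order 1/n^3, so the expansion converges
  absolutely and holds at a = 0 and a = 1 as well.\<close>

lemma sinh_quotient_partial_fractions:
  assumes t: "t > 0" and a: "0 \<le> a" "a \<le> 1"
  defines "c \<equiv> \<lambda>n. 2 * pi * real (Suc n)"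
  shows "(\<lambda>n. 4 * sin (c n * a) / (c n * (t\<^sup>2 + (c n)\<^sup>2))) sums
           ((1 - 2 * a - sinh ((1/2 - a) * t) / sinh (t / 2)) / t\<^sup>2)"
proof -
  \<comment> \<open>\<open>X\<close> and the explicit function \<open>Y\<close> below both satisfy \<open>X'' = t\<^sup>2 X - B\<^sub>2\<close>, where \<open>B\<^sub>2\<close> is the
    second Bernoulli polynomial, and their derivatives vanish at 0 and 1.\<close>
  define X where "X x = (\<Sum>n. 4 * cos (c n * x) / ((c n)\<^sup>2 * (t\<^sup>2 + (c n)\<^sup>2)))" for x
  define U where "U x = (\<Sum>n. - (4 * sin (c n * x) / (c n * (t\<^sup>2 + (c n)\<^sup>2))))" for x
  define V where "V x = (\<Sum>n. - (4 * cos (c n * x) / (t\<^sup>2 + (c n)\<^sup>2)))" for x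
  have c1: "1 \<le> c n" and c2: "4 / (c n)\<^sup>2 \<le> 1 / (real (Suc n))\<^sup>2" for n
    using two_pi_Suc_bounds[of n] by (simp_all add: c_def)
  have c0: "0 < c n" for n using c1[of n] by linarith
  \<comment> \<open>The free factor \<open>d\<close> covers the three denominators of
    \<open>X\<close>, \<open>U\<close> and \<open>V\<close>: d = c^2, d = c and d = 1.\<close>
  have frac: "\<bar>4 * y / (d * (t\<^sup>2 + (c n)\<^sup>2))\<bar> \<le> 1 / (real (Suc n))\<^sup>2" if "\<bar>y\<bar> \<le> 1" "1 \<le> d" for y d n
  proof -
    have "1 * (c n)\<^sup>2 \<le> d * (t\<^sup>2 + (c n)\<^sup>2)" using that by (intro mult_mono) auto
    then have "4 * \<bar>y\<bar> / (d * (t\<^sup>2 + (c n)\<^sup>2)) \<le> 4 / (c n)\<^sup>2"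
      using that c0[of n] by (intro frac_le) auto
    moreover have "\<bar>4 * y / (d * (t\<^sup>2 + (c n)\<^sup>2))\<bar> = 4 * \<bar>y\<bar> / (d * (t\<^sup>2 + (c n)\<^sup>2))"
      using that by (simp add: abs_mult)
    ultimately show ?thesis using c2[of n] by linarith
  qed
  have b0: "norm (4 * cos (c n * x) / ((c n)\<^sup>2 * (t\<^sup>2 + (c n)\<^sup>2))) \<le> 1 / (real (Suc n))\<^sup>2" for n x
    unfolding real_norm_def using c1[of n] by (intro frac) (auto simp: one_le_power)
  have b1: "norm (- (4 * sin (c n * x) / (c n * (t\<^sup>2 + (c n)\<^sup>2)))) \<le> 1 / (real (Suc n))\<^sup>2" for n x
    unfolding real_norm_def abs_minus_cancel using c1[of n] by (intro frac) auto
  have b2: "norm (- (4 * cos (c n * x) / (t\<^sup>2 + (c n)\<^sup>2))) \<le> 1 / (real (Suc n))\<^sup>2" for n x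
    using frac[of "cos (c n * x)" 1 n] by simp
  note sm = summable_inverse_squares_Suc
  have sum0: "summable (\<lambda>n. 4 * cos (c n * x) / ((c n)\<^sup>2 * (t\<^sup>2 + (c n)\<^sup>2)))" for x
    by (rule summable_comparison_test'[OF sm b0])
  have sum1: "summable (\<lambda>n. - (4 * sin (c n * x) / (c n * (t\<^sup>2 + (c n)\<^sup>2))))" for x
    by (rule summable_comparison_test'[OF sm b1])
  have DX: "(X has_real_derivative U x) (at x)" for x
    unfolding X_def U_def
  proof (rule has_field_derivative_series'(2)[where S=UNIV and ?x0.0=0 and x=x and
        f="\<lambda>n x. 4 * cos (c n * x) / ((c n)\<^sup>2 * (t\<^sup>2 + (c n)\<^sup>2))" and
        f'="\<lambda>n x. - (4 * sin (c n * x) / (c n * (t\<^sup>2 + (c n)\<^sup>2)))"])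
    show "((\<lambda>x. 4 * cos (c n * x) / ((c n)\<^sup>2 * (t\<^sup>2 + (c n)\<^sup>2))) has_real_derivative
      - (4 * sin (c n * x) / (c n * (t\<^sup>2 + (c n)\<^sup>2)))) (at x within UNIV)" for n x
    proof -
      have "((\<lambda>x. 4 * cos (c n * x)) has_real_derivative - (c n * (4 * sin (c n * x)))) (at x within UNIV)"
        by (auto intro!: derivative_eq_intros)
      from DERIV_cdivide[OF this, of "(c n)\<^sup>2 * (t\<^sup>2 + (c n)\<^sup>2)"] show ?thesis
        using c0[of n] by (simp add: power2_eq_square mult.assoc)
    qed
    show "uniformly_convergent_on UNIV (\<lambda>n x. \<Sum>i<n. - (4 * sin (c i * x) / (c i * (t\<^sup>2 + (c i)\<^sup>2))))"
      by (rule Weierstrass_m_test'[OF b1 sm])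
  qed (rule sum0 | simp)+
  have DU: "(U has_real_derivative V x) (at x)" for x
    unfolding U_def V_def
  proof (rule has_field_derivative_series'(2)[where S=UNIV and ?x0.0=0 and x=x and
        f="\<lambda>n x. - (4 * sin (c n * x) / (c n * (t\<^sup>2 + (c n)\<^sup>2)))" and
        f'="\<lambda>n x. - (4 * cos (c n * x) / (t\<^sup>2 + (c n)\<^sup>2))"])
    show "((\<lambda>x. - (4 * sin (c n * x) / (c n * (t\<^sup>2 + (c n)\<^sup>2)))) has_real_derivative
      - (4 * cos (c n * x) / (t\<^sup>2 + (c n)\<^sup>2))) (at x within UNIV)" for n x
    proof -
      have "((\<lambda>x. - (4 * sin (c n * x))) has_real_derivative c n * - (4 * cos (c n * x))) (at x within UNIV)"
        by (auto intro!: derivative_eq_intros)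
      from DERIV_cdivide[OF this, of "c n * (t\<^sup>2 + (c n)\<^sup>2)"] show ?thesis
        using c0[of n] by simp
    qed
    show "uniformly_convergent_on UNIV (\<lambda>n x. \<Sum>i<n. - (4 * cos (c i * x) / (t\<^sup>2 + (c i)\<^sup>2)))"
      by (rule Weierstrass_m_test'[OF b2 sm])
  qed (rule sum1 | simp)+
  \<comment> \<open>This is t^2 / (c^2 (t^2 + c^2)) - 1 / c^2 = - 1 / (t^2 + c^2), summed against
    the Fourier series of B_2.\<close>
  have VX: "V x = t\<^sup>2 * X x - (x\<^sup>2 - x + 1/6)" if "x \<in> {0..1}" for x
  proof -
    have "(\<lambda>n. t\<^sup>2 * (4 * cos (c n * x) / ((c n)\<^sup>2 * (t\<^sup>2 + (c n)\<^sup>2))) - 4 * cos (c n * x) / (c n)\<^sup>2)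
        sums (t\<^sup>2 * X x - (x\<^sup>2 - x + 1/6))"
      unfolding X_def using bernoulli2_fourier[of x] that
      by (intro sums_diff sums_mult summable_sums sum0) (auto simp: c_def)
    also have "(\<lambda>n. t\<^sup>2 * (4 * cos (c n * x) / ((c n)\<^sup>2 * (t\<^sup>2 + (c n)\<^sup>2))) - 4 * cos (c n * x) / (c n)\<^sup>2)
       = (\<lambda>n. - (4 * cos (c n * x) / (t\<^sup>2 + (c n)\<^sup>2)))"
    proof
      fix n
      have "t\<^sup>2 + (c n)\<^sup>2 \<noteq> 0" "(c n)\<^sup>2 \<noteq> 0" using c0[of n] t by (auto simp: add_nonneg_eq_0_iff)
      then show "t\<^sup>2 * (4 * cos (c n * x) / ((c n)\<^sup>2 * (t\<^sup>2 + (c n)\<^sup>2))) - 4 * cos (c n * x) / (c n)\<^sup>2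
         = - (4 * cos (c n * x) / (t\<^sup>2 + (c n)\<^sup>2))"
        by (simp add: divide_simps) (simp add: algebra_simps)
    qed
    finally show ?thesis by (simp add: V_def sums_iff)
  qed
  have sh: "sinh (t / 2) \<noteq> 0" using t by simp
  \<comment> \<open>The first fraction is the polynomial solution of the inhomogeneous equation. The
    homogeneous solution cosh is centred at 1/2 by symmetry, and its coefficient is chosen to make
    \<open>Y'\<close> vanish at both ends.\<close>
  define Y where "Y x = (x\<^sup>2 - x + 1/6 + 2 / t\<^sup>2) / t\<^sup>2 - cosh ((1/2 - x) * t) / (t ^ 3 * sinh (t / 2))" for x
  define Y' where "Y' x = (2 * x - 1) / t\<^sup>2 + sinh ((1/2 - x) * t) / (t\<^sup>2 * sinh (t / 2))" for x
  have DY: "(Y has_real_derivative Y' x) (at x within A)" for x A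
    unfolding Y_def Y'_def using t sh
    by (auto intro!: derivative_eq_intros simp: power2_eq_square power3_eq_cube)
  have DY': "(Y' has_real_derivative t\<^sup>2 * Y x - (x\<^sup>2 - x + 1/6)) (at x within A)" for x A
  proof -
    have "(Y' has_real_derivative 2 / t\<^sup>2 - cosh ((1/2 - x) * t) / (t * sinh (t / 2))) (at x within A)"
      unfolding Y'_def using t sh
      by (auto intro!: derivative_eq_intros simp: power2_eq_square)
    also have "2 / t\<^sup>2 - cosh ((1/2 - x) * t) / (t * sinh (t / 2)) = t\<^sup>2 * Y x - (x\<^sup>2 - x + 1/6)"
      unfolding Y_def using t sh by (simp add: field_simps power2_eq_square power3_eq_cube)
    finally show ?thesis .
  qed
  have "U a - Y' a = 0"
  proof (rule neumann_ode_unique[OF t, where w="\<lambda>x. X x - Y x" and w'="\<lambda>x. U x - Y' x"])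
    show "((\<lambda>x. X x - Y x) has_real_derivative U x - Y' x) (at x within {0..1})" for x
      by (intro DERIV_diff DY has_field_derivative_at_within[OF DX])
    show "((\<lambda>x. U x - Y' x) has_real_derivative t\<^sup>2 * (X x - Y x)) (at x within {0..1})" if "x \<in> {0..1}" for x
    proof -
      have "((\<lambda>x. U x - Y' x) has_real_derivative V x - (t\<^sup>2 * Y x - (x\<^sup>2 - x + 1/6))) (at x within {0..1})"
        by (intro DERIV_diff DY' has_field_derivative_at_within[OF DU])
      then show ?thesis using VX[OF that] by (simp add: algebra_simps)
    qed
    have "sin (c n) = 0" for n
      using sin_npi[of "2 * Suc n"] by (simp add: c_def mult_ac)
    then show "U 0 - Y' 0 = 0" "U 1 - Y' 1 = 0"
      using t sh sinh_minus[of "t / 2"] by (auto simp: U_def Y'_def field_simps)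
  qed (use a in auto)
  then have "(\<Sum>n. - (4 * sin (c n * a) / (c n * (t\<^sup>2 + (c n)\<^sup>2)))) = Y' a" by (simp add: U_def)
  then have "(\<lambda>n. - (4 * sin (c n * a) / (c n * (t\<^sup>2 + (c n)\<^sup>2)))) sums Y' a"
    using sum1 by (simp add: sums_iff)
  from sums_minus[OF this] have "(\<lambda>n. 4 * sin (c n * a) / (c n * (t\<^sup>2 + (c n)\<^sup>2))) sums (- Y' a)" by simp
  also have "- Y' a = (1 - 2 * a - sinh ((1/2 - a) * t) / sinh (t / 2)) / t\<^sup>2"
    unfolding Y'_def using t sh by (simp add: field_simps)
  finally show ?thesis .
qed

section \<open>Analytic continuation of the Hurwitz zeta function\<close>

text \<open>Monotone convergence applied to the partial sums of the norms produces an integrable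
  majorant, and dominated convergence does the rest. The integrals of the norms enter as explicit
  values \<open>K\<close>, since they are computable in every application.\<close>

lemma has_integral_sums:
  fixes f :: "nat \<Rightarrow> 'a::euclidean_space \<Rightarrow> 'b::euclidean_space"
  assumes f: "\<And>n. (f n has_integral I n) S"
    and K: "\<And>n. ((\<lambda>x. norm (f n x)) has_integral K n) S" "summable K"
    and abs: "\<And>x. x \<in> S \<Longrightarrow> summable (\<lambda>n. norm (f n x))"
    and g: "\<And>x. x \<in> S \<Longrightarrow> (\<lambda>n. f n x) sums g x"
  shows "g absolutely_integrable_on S" "I sums integral S g"
proof -
  define h where "h x = (\<Sum>n. norm (f n x))" for x
  have fabs: "f n absolutely_integrable_on S" for n
    using f[of n] K(1)[of n] unfolding absolutely_integrable_on_def by blast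
  have K0: "0 \<le> K n" for n
    using has_integral_nonneg[OF K(1)[of n]] by simp
  have h: "h integrable_on S \<and> (\<lambda>N. integral S (\<lambda>x. \<Sum>n<N. norm (f n x))) \<longlonglongrightarrow> integral S h"
  proof (rule monotone_convergence_increasing)
    show "(\<lambda>x. \<Sum>n<N. norm (f n x)) integrable_on S" for N
      using K(1) by (intro integrable_sum) blast+
    show "(\<lambda>N. \<Sum>n<N. norm (f n x)) \<longlonglongrightarrow> h x" if "x \<in> S" for x
      unfolding h_def using abs[OF that] by (rule summable_LIMSEQ)
    have eq: "integral S (\<lambda>x. \<Sum>n<N. norm (f n x)) = (\<Sum>n<N. K n)" for N
      by (intro integral_unique has_integral_sum K) auto
    show "bounded (range (\<lambda>N. integral S (\<lambda>x. \<Sum>n<N. norm (f n x))))"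
      unfolding eq using summable_LIMSEQ[OF K(2)] convergent_imp_bounded by blast
  qed simp
  have le: "norm (\<Sum>n<N. f n x) \<le> h x" if "x \<in> S" for x N
  proof -
    have "norm (\<Sum>n<N. f n x) \<le> (\<Sum>n<N. norm (f n x))" by (rule norm_sum)
    also have "\<dots> \<le> h x" unfolding h_def using abs[OF that] by (intro sum_le_suminf) auto
    finally show ?thesis .
  qed
  have lim: "(\<lambda>N. \<Sum>n<N. f n x) \<longlonglongrightarrow> g x" if "x \<in> S" for x
    using g[OF that] by (simp add: sums_def)
  have "norm (g x) \<le> h x" if "x \<in> S" for x
    by (rule LIMSEQ_le_const2[OF tendsto_norm[OF lim[OF that]]]) (use le[OF that] in auto)
  then show "g absolutely_integrable_on S"
  proof (rule dominated_convergence_absolutely_integrable[rotated 2])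
    show "(\<lambda>x. \<Sum>n<N. f n x) absolutely_integrable_on S" for N
      using fabs by (intro absolutely_integrable_sum) auto
  qed (use h lim in auto)
  have "(\<lambda>N. integral S (\<lambda>x. \<Sum>n<N. f n x)) \<longlonglongrightarrow> integral S g"
  proof (rule dominated_convergence(2)[where h=h])
    show "(\<lambda>x. \<Sum>n<N. f n x) integrable_on S" for N
      using f by (intro integrable_sum) blast+
  qed (use h le lim in auto)
  moreover have "integral S (\<lambda>x. \<Sum>n<N. f n x) = (\<Sum>n<N. I n)" for N
    by (intro integral_unique has_integral_sum f) auto
  ultimately show "I sums integral S g" by (simp add: sums_def)
qed

lemma has_integral_powr_exp:
  assumes s: "Re s > 0" and b: "b > 0"
  shows "((\<lambda>t. of_real t powr (s - 1) * of_real (exp (- (b * t)))) has_integral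
           Gamma s * of_real b powr (- s)) {0<..}"
    and "(\<lambda>t. of_real t powr (s - 1) * of_real (exp (- (b * t)))) absolutely_integrable_on {0<..}"
proof -
  let ?f = "\<lambda>t::real. of_real t powr (s - 1) / of_real (exp t) :: complex"
  let ?h = "\<lambda>t::real. of_real t powr (s - 1) * of_real (exp (- (b * t))) :: complex"
  show abs: "?h absolutely_integrable_on {0<..}"
    using absolutely_integrable_Gamma_integral[OF s b] by (simp add: exp_minus field_simps)
  have img: "(\<lambda>t. b * t) ` {0<..} = {0<..}"
  proof (intro equalityI subsetI)
    fix y :: real assume "y \<in> {0<..}"
    then show "y \<in> (\<lambda>t. b * t) ` {0<..}" using b by (intro image_eqI[of _ _ "y / b"]) auto
  qed (use b in auto)
  have inj: "inj_on (\<lambda>t. b * t) {0<..}" using b by (auto simp: inj_on_def)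
  have "(\<lambda>x. \<bar>b\<bar> *\<^sub>R ?f (b * x)) absolutely_integrable_on {0<..} \<and>
           integral {0<..} (\<lambda>x. \<bar>b\<bar> *\<^sub>R ?f (b * x)) = Gamma s"
    by (subst has_absolute_integral_change_of_variables_real[where g="\<lambda>t. b * t" and h="\<lambda>_. b"])
       (use inj img b absolutely_integrable_Gamma_integral'[OF s] integral_unique[OF Gamma_integral_complex'[OF s]]
         in \<open>auto intro!: derivative_eq_intros\<close>)
  then have "((\<lambda>x. \<bar>b\<bar> *\<^sub>R ?f (b * x)) has_integral Gamma s) {0<..}"
    using set_lebesgue_integral_eq_integral(1) by (metis integrable_integral)
  from has_integral_mult_right[OF this, of "of_real b powr (- s)"]
  have "((\<lambda>x. of_real b powr (- s) * (\<bar>b\<bar> *\<^sub>R ?f (b * x))) has_integral of_real b powr (- s) * Gamma s) {0<..}" .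
  then show "(?h has_integral Gamma s * of_real b powr (- s)) {0<..}"
    unfolding mult.commute[of _ "Gamma s"]
  proof (rule has_integral_eq[rotated])
    fix t :: real assume t: "t \<in> {0<..}"
    have 1: "of_real (b * t) powr (s - 1) = of_real b powr (s - 1) * complex_of_real t powr (s - 1)"
      using b t powr_times_real[of "of_real b" "of_real t" "s - 1"] by simp
    have 2: "of_real b powr (- s) * (of_real b * of_real b powr (s - 1)) = (1::complex)"
      using b by (simp add: powr_diff powr_minus)
    have "of_real b powr (- s) * (\<bar>b\<bar> *\<^sub>R ?f (b * t))
      = (of_real b powr (- s) * (of_real b * of_real b powr (s - 1))) * ?h t"
      unfolding 1 using b by (simp add: scaleR_conv_of_real exp_minus divide_inverse mult_ac)
    then show "of_real b powr (- s) * (\<bar>b\<bar> *\<^sub>R ?f (b * t)) = ?h t"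
      unfolding 2 by simp
  qed
qed

text \<open>Multiplied by t this is t e^((1-a)t) / (e^t - 1), the generating function of the
  Bernoulli polynomials at 1 - a.\<close>

definition bose_kernel :: "real \<Rightarrow> real \<Rightarrow> real"
  where "bose_kernel a t = exp (- (a * t)) / (1 - exp (- t))"

text \<open>The kernel is a geometric series in e^(-t), each term of which integrates to a Gamma
  integral. The norms integrate to the same formula at the real exponent Re s, so termwise
  integration rests on the convergence of the sum of (k + a)^(-Re s).\<close>

lemma hurwitz_series_integral:
  assumes s: "Re s > 1" and a: "a > 0"
  shows "(\<lambda>t. of_real t powr (s - 1) * of_real (bose_kernel a t)) absolutely_integrable_on {0<..}"
    and "(\<lambda>k. of_real (real k + a) powr (- s)) sums
           (rGamma s * integral {0<..} (\<lambda>t. of_real t powr (s - 1) * of_real (bose_kernel a t)))"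
proof -
  let ?\<sigma> = "Re s"
  define f where "f k t = of_real t powr (s - 1) * complex_of_real (exp (- ((real k + a) * t)))" for k t
  define g where "g t = of_real t powr (s - 1) * complex_of_real (bose_kernel a t)" for t
  have ka: "real k + a > 0" for k using a by linarith
  have norm_f: "norm (f k t) = t powr (?\<sigma> - 1) * exp (- ((real k + a) * t))" if "t > 0" for k t
    using that by (simp add: f_def norm_mult norm_powr_real_powr)
  have f: "(f k has_integral Gamma s * of_real (real k + a) powr (- s)) {0<..}" for k
    unfolding f_def using s ka[of k] by (intro has_integral_powr_exp) auto
  have K: "((\<lambda>t. norm (f k t)) has_integral Gamma ?\<sigma> * (real k + a) powr (- ?\<sigma>)) {0<..}" for k
  proof -
    have "((\<lambda>t. of_real t powr (of_real ?\<sigma> - 1) * of_real (exp (- ((real k + a) * t)))) has_integral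
       Gamma (of_real ?\<sigma>) * of_real (real k + a) powr (- complex_of_real ?\<sigma>)) {0<..}"
      using s ka[of k] by (intro has_integral_powr_exp) auto
    then have "((\<lambda>t. Re (of_real t powr (of_real ?\<sigma> - 1) * of_real (exp (- ((real k + a) * t))))) has_integral
       Re (Gamma (of_real ?\<sigma>) * of_real (real k + a) powr (- complex_of_real ?\<sigma>))) {0<..}"
      by (rule has_integral_Re)
    also have "Gamma (of_real ?\<sigma>) * of_real (real k + a) powr (- complex_of_real ?\<sigma>)
      = of_real (Gamma ?\<sigma> * (real k + a) powr (- ?\<sigma>))"
      using ka[of k] by (simp add: Gamma_complex_of_real powr_of_real[symmetric])
    finally have "((\<lambda>t. Re (of_real t powr (of_real ?\<sigma> - 1) * of_real (exp (- ((real k + a) * t))))) has_integral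
       Gamma ?\<sigma> * (real k + a) powr (- ?\<sigma>)) {0<..}" by simp
    then show ?thesis
    proof (rule has_integral_eq[rotated])
      fix t :: real assume t: "t \<in> {0<..}"
      then have "complex_of_real t powr (of_real ?\<sigma> - 1) = of_real (t powr (?\<sigma> - 1))"
        using powr_of_real[of t "?\<sigma> - 1"] by simp
      then show "Re (of_real t powr (of_real ?\<sigma> - 1) * of_real (exp (- ((real k + a) * t)))) = norm (f k t)"
        using t norm_f[of t k] by simp
    qed
  qed
  have sumK: "summable (\<lambda>k. Gamma ?\<sigma> * (real k + a) powr (- ?\<sigma>))"
  proof (rule summable_mult, rule summable_comparison_test_ev)
    show "summable (\<lambda>k. real k powr (- ?\<sigma>))" using s by (simp add: summable_real_powr_iff)
    \<comment> \<open>The comparison fails at k = 0, because \<open>0 powr\<close> any exponent is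
      0.\<close>
    show "eventually (\<lambda>k. norm ((real k + a) powr (- ?\<sigma>)) \<le> real k powr (- ?\<sigma>)) sequentially"
      using eventually_gt_at_top[of "0::nat"]
    proof eventually_elim
      case (elim k)
      then show ?case using a s by (simp add: powr_mono2')
    qed
  qed
  have exp_eq: "exp (- ((real k + a) * t)) = exp (- (a * t)) * exp (- t) ^ k" for k t
    by (simp add: exp_of_nat_mult[symmetric] mult_exp_exp algebra_simps)
  have geo: "(\<lambda>k. exp (- ((real k + a) * t))) sums bose_kernel a t" if "t > 0" for t
    unfolding exp_eq bose_kernel_def using sums_mult[OF geometric_sums[of "exp (- t)"], of "exp (- (a * t))"] that by simp
  have abs: "summable (\<lambda>k. norm (f k t))" if "t \<in> {0<..}" for t
    using that summable_mult[OF sums_summable[OF geo[of t]], of "t powr (?\<sigma> - 1)"] by (simp add: norm_f)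
  have lim: "(\<lambda>k. f k t) sums g t" if "t \<in> {0<..}" for t
    unfolding f_def g_def using that by (intro sums_mult sums_of_real geo) auto
  show "g absolutely_integrable_on {0<..}" by (rule has_integral_sums(1)[OF f K sumK abs lim])
  have "(\<lambda>k. Gamma s * of_real (real k + a) powr (- s)) sums integral {0<..} g"
    by (rule has_integral_sums(2)[OF f K sumK abs lim])
  from sums_mult[OF this, of "rGamma s"]
  show "(\<lambda>k. of_real (real k + a) powr (- s)) sums (rGamma s * integral {0<..} g)"
  proof -
    have "s \<notin> \<int>\<^sub>\<le>\<^sub>0" using s by (auto elim!: nonpos_Ints_cases)
    then have "rGamma s * (Gamma s * z) = z" for z
      by (simp add: rGamma_inverse_Gamma Gamma_eq_zero_iff)
    with \<open>(\<lambda>k. rGamma s * _ k) sums _\<close> show ?thesis by simp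
  qed
qed

text \<open>Each t^(w + n) integrates to 1 / (w + n + 1), and these factors are bounded in n. It is
  applied with w = s - 2 to a kernel and with w = 0 to the remainder of a Taylor expansion.\<close>

lemma power_series_integral:
  fixes d :: "nat \<Rightarrow> complex"
  assumes w: "Re w > -1" and d: "summable (\<lambda>n. norm (d n))"
    and g: "\<And>t. t \<in> {0<..1} \<Longrightarrow> (\<lambda>n. d n * of_real t ^ n) sums g t"
  shows "(\<lambda>t. of_real t powr w * g t) absolutely_integrable_on {0<..1}"
    and "(\<lambda>n. d n / (w + of_nat n + 1)) sums integral {0<..1} (\<lambda>t. of_real t powr w * g t)"
proof -
  define f where "f n t = of_real t powr w * (d n * of_real t ^ n)" for n and t :: real
  have Ioc: "(h has_integral I) {0<..1} \<longleftrightarrow> (h has_integral I) {0..1}" for h :: "real \<Rightarrow> 'z::banach" and I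
    by (rule has_integral_spike_set_eq) (auto intro: negligible_subset[of "{0}"])
  have f: "(f n has_integral d n / (w + of_nat n + 1)) {0<..1}" for n
  proof -
    let ?z = "w + of_nat n + 1"
    have z: "Re ?z > 0" using w by simp
    then have z0: "?z \<noteq> 0" by force
    have "((\<lambda>t. of_real t powr (?z - 1)) has_integral (of_real 1 powr ?z / ?z - of_real 0 powr ?z / ?z)) {0..1}"
      using z z0 by (intro fundamental_theorem_of_calculus_interior)
        (auto intro!: continuous_intros derivative_eq_intros has_vector_derivative_real_field)
    from has_integral_mult_right[OF this, of "d n"]
    have "((\<lambda>t. d n * of_real t powr (?z - 1)) has_integral d n / ?z) {0<..1}" by (simp add: Ioc)
    then show ?thesis
    proof (rule has_integral_eq[rotated])
      fix t :: real assume t: "t \<in> {0<..1}"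
      have "of_real t powr (?z - 1) = complex_of_real t powr w * of_real t powr of_nat n"
        by (simp add: powr_add)
      then show "d n * of_real t powr (?z - 1) = f n t"
        using t by (simp add: f_def powr_nat')
    qed
  qed
  have norm_f: "norm (f n t) = norm (d n) * t powr (Re w + real n)" if "t > 0" for n t
    using that by (simp add: f_def norm_mult norm_power norm_powr_real_powr powr_add powr_realpow)
  have K: "((\<lambda>t. norm (f n t)) has_integral norm (d n) * (1 / (Re w + real n + 1))) {0<..1}" for n
  proof -
    have "((\<lambda>t. t powr (Re w + real n)) has_integral 1 powr (Re w + real n + 1) / (Re w + real n + 1)) {0..1}"
      using w by (intro has_integral_powr_from_0) auto
    then have "((\<lambda>t. norm (d n) * t powr (Re w + real n)) has_integral norm (d n) * (1 / (Re w + real n + 1))) {0<..1}"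
      unfolding Ioc by (intro has_integral_mult_right) simp
    then show ?thesis by (rule has_integral_eq[rotated]) (simp add: norm_f)
  qed
  have sumK: "summable (\<lambda>n. norm (d n) * (1 / (Re w + real n + 1)))"
  proof (rule summable_comparison_test'[OF summable_mult2[OF d]])
    fix n
    have "1 / (Re w + real n + 1) \<le> 1 / (Re w + 1)" using w by (intro divide_left_mono) auto
    then show "norm (norm (d n) * (1 / (Re w + real n + 1))) \<le> norm (d n) * (1 / (Re w + 1))"
      using w by (simp add: abs_mult mult_left_mono del: times_divide_eq_right)
  qed
  have abs: "summable (\<lambda>n. norm (f n t))" if t: "t \<in> {0<..1}" for t
  proof (rule summable_comparison_test'[OF summable_mult[OF d, of "t powr Re w"]])
    fix n
    have "norm (d n) * t ^ n \<le> norm (d n) * 1" using t by (intro mult_left_mono power_le_one) auto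
    then show "norm (norm (f n t)) \<le> t powr Re w * norm (d n)"
      using t by (simp add: f_def norm_mult norm_power norm_powr_real_powr mult_left_mono)
  qed
  have lim: "(\<lambda>n. f n t) sums (of_real t powr w * g t)" if "t \<in> {0<..1}" for t
    unfolding f_def by (intro sums_mult g that)
  show "(\<lambda>t. of_real t powr w * g t) absolutely_integrable_on {0<..1}"
    by (rule has_integral_sums(1)[OF f K sumK abs lim])
  show "(\<lambda>n. d n / (w + of_nat n + 1)) sums integral {0<..1} (\<lambda>t. of_real t powr w * g t)"
    by (rule has_integral_sums(2)[OF f K sumK abs lim])
qed

section \<open>The kernel near zero and near infinity\<close>

text \<open>The function is e^(-az) / E(z), where E extends (1 - e^(-z)) / z to an entire function.
  The zeros of E are nonzero multiples of 2 pi i, so a disc of radius larger than 1 is free of them,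
  and that makes the coefficients absolutely summable.\<close>

lemma bose_power_series:
  obtains d :: "nat \<Rightarrow> complex" where "summable (\<lambda>n. norm (d n))"
    "\<And>t. t \<in> {0<..1} \<Longrightarrow> (\<lambda>n. d n * of_real t ^ n) sums of_real (t * bose_kernel a t)"
proof -
  define E where "E z = (if z = 0 then 1 else (1 - exp (- z)) / z)" for z :: complex
  define G where "G z = exp (- (of_real a * z)) / E z" for z
  have E: "E holomorphic_on UNIV"
  proof (rule no_isolated_singularity[of _ _ "{0}"])
    have hol: "(\<lambda>z. (1 - exp (- z)) / z) holomorphic_on - {0::complex}" by (intro holomorphic_intros) auto
    then have "E holomorphic_on - {0}"
      by (rule holomorphic_transform) (auto simp: E_def)
    then show "E holomorphic_on UNIV - {0}" by (simp add: Compl_eq_Diff_UNIV)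
    have "((\<lambda>z::complex. 1 - exp (- z)) has_field_derivative 1) (at 0)"
      by (auto intro!: derivative_eq_intros)
    then have "(\<lambda>z::complex. (1 - exp (- z)) / z) \<midarrow>0\<rightarrow> 1"
      by (simp add: has_field_derivative_iff)
    then have "E \<midarrow>0\<rightarrow> 1"
      by (rule Lim_transform_within[where d=1]) (auto simp: E_def)
    then have "isCont E 0" by (simp add: isCont_def E_def)
    moreover have "isCont E z" if "z \<noteq> 0" for z
    proof -
      have "continuous_on (- {0}) E"
        using holomorphic_on_imp_continuous_on[OF hol] by (rule continuous_on_eq) (auto simp: E_def)
      then show ?thesis using that by (simp add: continuous_on_eq_continuous_at open_Compl)
    qed
    ultimately show "continuous_on UNIV E" by (metis continuous_at_imp_continuous_on)
  qed auto
  have E0: "E z \<noteq> 0" if "z \<in> ball 0 2" for z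
  proof
    assume "E z = 0"
    then have z: "z \<noteq> 0" "exp (- z) = 1" by (auto simp: E_def split: if_splits)
    then obtain k :: int where k: "Re z = 0" "Im (- z) = of_int (2 * k) * pi" by (auto simp: exp_eq_1)
    have "k \<noteq> 0" using k z(1) by (auto simp: complex_eq_iff)
    then have "1 \<le> \<bar>real_of_int k\<bar>" by linarith
    then have "2 * 2 \<le> (2 * \<bar>real_of_int k\<bar>) * pi" using pi_ge_two by (intro mult_mono) auto
    also have "\<dots> = \<bar>Im z\<bar>" using k(2) by (simp add: abs_mult flip: abs_minus_cancel[of "Im z"])
    also have "\<dots> \<le> norm z" by (rule abs_Im_le_cmod)
    finally show False using that by simp
  qed
  have G: "G holomorphic_on ball 0 2"
    unfolding G_def using E0 by (intro holomorphic_intros holomorphic_on_subset[OF E]) auto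
  define d where "d n = (deriv ^^ n) G 0 / fact n" for n
  have ps: "(\<lambda>n. d n * z ^ n) sums G z" if "z \<in> ball 0 2" for z
    using holomorphic_power_series[OF G that] by (simp add: d_def)
  \<comment> \<open>Convergence at 3/2, inside the disc of radius 2, gives absolute convergence at
    1.\<close>
  have "summable (\<lambda>n. norm (d n * 1 ^ n))"
    using sums_summable[OF ps[of "3 / 2"]] by (rule powser_insidea) auto
  then have "summable (\<lambda>n. norm (d n))" by simp
  moreover have "(\<lambda>n. d n * of_real t ^ n) sums of_real (t * bose_kernel a t)" if "t \<in> {0<..1}" for t
    using ps[of "of_real t"] that by (simp add: G_def E_def bose_kernel_def field_simps exp_of_real flip: of_real_exp of_real_mult of_real_minus)
  ultimately show ?thesis by (rule that)
qed

text \<open>Integrals over [1, N + 1] are holomorphic by differentiation under the integral sign.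
  They converge locally uniformly, since the norm of the integrand increases with Re s for t >= 1
  and one exponent \<open>R\<close> dominates a whole disc.\<close>

lemma mellin_tail_holomorphic:
  fixes k :: "real \<Rightarrow> complex"
  assumes k: "continuous_on {1..} k"
    and int: "\<And>R. R > 1 \<Longrightarrow> (\<lambda>t. t powr R * norm (k t)) integrable_on {1..}"
  shows "(\<lambda>t. of_real t powr w * k t) absolutely_integrable_on {1..}"
    and "(\<lambda>s. integral {1..} (\<lambda>t. of_real t powr (s - 1) * k t)) holomorphic_on UNIV"
proof -
  define f where "f s t = of_real t powr (s - 1) * k t" for s and t :: real
  have cont: "continuous_on {1..} (\<lambda>t. of_real t powr w * k t)" for w
    by (intro continuous_intros k) auto
  have bound: "norm (of_real t powr w * k t) \<le> t powr R * norm (k t)" if "t \<ge> 1" "Re w \<le> R" for t R w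
    using that by (simp add: norm_mult norm_powr_real_powr mult_right_mono powr_mono)
  have abs: "(\<lambda>t. of_real t powr w * k t) absolutely_integrable_on {1..}" for w
    by (rule measurable_bounded_by_integrable_imp_absolutely_integrable
        [OF continuous_imp_measurable_on_sets_lebesgue[OF cont] _ int[of "max 2 (Re w)"]])
       (auto intro: bound)
  show "(\<lambda>t. of_real t powr w * k t) absolutely_integrable_on {1..}" by (rule abs)
  have sub: "h absolutely_integrable_on {real N + 1..}" "h absolutely_integrable_on {1..real N + 1}"
    "integral {1..} h = integral {1..real N + 1} h + integral {real N + 1..} h"
    if h: "h absolutely_integrable_on {1..}" for h :: "real \<Rightarrow> 'z::euclidean_space" and N
  proof -
    show h1: "h absolutely_integrable_on {real N + 1..}" and h2: "h absolutely_integrable_on {1..real N + 1}"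
      by (auto intro: set_integrable_subset[OF h])
    have "(h has_integral (integral {1..real N + 1} h + integral {real N + 1..} h)) ({1..real N + 1} \<union> {real N + 1..})"
      using h1 h2 set_lebesgue_integral_eq_integral(1)
      by (intro has_integral_Un integrable_integral) (auto intro: negligible_subset[of "{real N + 1}"])
    also have "{1..real N + 1} \<union> {real N + 1..} = {1..}" by auto
    finally show "integral {1..} h = integral {1..real N + 1} h + integral {real N + 1..} h" by blast
  qed
  have tail: "(\<lambda>N. integral {real N + 1..} (\<lambda>t. t powr R * norm (k t))) \<longlonglongrightarrow> 0" if R: "R > 1" for R
  proof -
    let ?h = "\<lambda>t. t powr R * norm (k t)"
    have h: "?h absolutely_integrable_on {1..}"
      using int[OF R] by (intro nonnegative_absolutely_integrable_1) auto
    have "(\<lambda>N. integral {1..} (\<lambda>t. if t \<in> {1..real N + 1} then ?h t else 0)) \<longlonglongrightarrow> integral {1..} ?h"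
    proof (rule dominated_convergence(2)[OF _ int[OF R]])
      fix t :: real
      have "eventually (\<lambda>N. t \<le> real N + 1) sequentially"
        using eventually_ge_at_top[of "nat \<lceil>t\<rceil>"] by eventually_elim linarith
      then show "(\<lambda>N. if t \<in> {1..real N + 1} then ?h t else 0) \<longlonglongrightarrow> ?h t" if "t \<in> {1..}"
        using that by (intro tendsto_eventually) (erule eventually_mono, simp)
    next
      fix N
      have "{1..real N + 1} \<inter> {1..} = {1..real N + 1}" by auto
      then show "(\<lambda>t. if t \<in> {1..real N + 1} then ?h t else 0) integrable_on {1..}"
        using sub(2)[OF h] set_lebesgue_integral_eq_integral(1)
        by (subst integrable_restrict_Int) auto
    qed auto
    moreover have "integral {1..} (\<lambda>t. if t \<in> {1..real N + 1} then ?h t else 0) = integral {1..real N + 1} ?h" for N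
    proof -
      have "{1..real N + 1} \<inter> {1..} = {1..real N + 1}" by auto
      then show ?thesis by (subst Henstock_Kurzweil_Integration.integral_restrict_Int) simp
    qed
    ultimately have "(\<lambda>N. integral {1..} ?h - integral {1..real N + 1} ?h) \<longlonglongrightarrow> integral {1..} ?h - integral {1..} ?h"
      by (intro tendsto_intros) simp
    moreover have "integral {1..} ?h - integral {1..real N + 1} ?h = integral {real N + 1..} ?h" for N
      unfolding sub(3)[OF h, of N] by simp
    ultimately show ?thesis by (simp only: diff_self)
  qed
  have "(\<lambda>s. integral {1..} (f s)) holomorphic_on UNIV"
  proof (rule holomorphic_uniform_sequence[where f="\<lambda>N s. integral {1..real N + 1} (f s)"])
    show "(\<lambda>s. integral {1..real N + 1} (f s)) holomorphic_on UNIV" for N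
    proof (rule leibniz_rule_holomorphic[where a=1 and b="real N + 1" and U=UNIV, unfolded box_real])
      show "((\<lambda>s. f s t) has_field_derivative of_real t powr (s - 1) * Ln (of_real t) * k t) (at s within UNIV)"
        if "t \<in> {1..real N + 1}" for s t
        unfolding f_def powr_def using that by (auto intro!: derivative_eq_intros)
      show "f s integrable_on {1..real N + 1}" for s
        unfolding f_def using sub(2)[OF abs] set_lebesgue_integral_eq_integral(1) by blast
      have "continuous_on (UNIV \<times> {1..real N + 1}) (\<lambda>p. k (snd p))"
        by (intro continuous_on_compose2[OF k] continuous_intros) auto
      then show "continuous_on (UNIV \<times> {1..real N + 1})
          (\<lambda>(s, t). of_real t powr (s - 1) * Ln (of_real t) * k t)"
        unfolding case_prod_unfold by (intro continuous_intros) auto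
    qed auto
    fix z :: complex
    \<comment> \<open>On \<open>cball z 1\<close> one has Re (s - 1) <= Re z, and the value 2 keeps
      \<open>R\<close> in the range covered by \<open>int\<close>.\<close>
    define R where "R = max 2 (Re z)"
    have "uniform_limit (cball z 1) (\<lambda>N s. integral {1..real N + 1} (f s)) (\<lambda>s. integral {1..} (f s)) sequentially"
    proof (rule uniform_limitI)
      fix e :: real assume e: "e > 0"
      have "eventually (\<lambda>N. dist (integral {real N + 1..} (\<lambda>t. t powr R * norm (k t))) 0 < e) sequentially"
        using tail[of R] e unfolding R_def by (intro tendstoD) auto
      then show "eventually (\<lambda>N. \<forall>s\<in>cball z 1. dist (integral {1..real N + 1} (f s)) (integral {1..} (f s)) < e) sequentially"
      proof eventually_elim
        case (elim N)
        show ?case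
        proof
          fix s assume s: "s \<in> cball z 1"
          have "Re s - Re z \<le> 1" using s abs_Re_le_cmod[of "z - s"] by (simp add: dist_norm)
          then have re: "Re (s - 1) \<le> R" by (simp add: R_def)
          have fs: "f s absolutely_integrable_on {1..}" unfolding f_def by (rule abs)
          have h: "(\<lambda>t. t powr R * norm (k t)) absolutely_integrable_on {1..}"
            using int[of R] by (intro nonnegative_absolutely_integrable_1) (auto simp: R_def)
          have "norm (integral {real N + 1..} (f s)) \<le> integral {real N + 1..} (\<lambda>t. t powr R * norm (k t))"
          proof (rule integral_norm_bound_integral)
            show "norm (f s t) \<le> t powr R * norm (k t)" if "t \<in> {real N + 1..}" for t
              unfolding f_def using that re by (intro bound) auto
          qed (use sub(1)[OF fs] sub(1)[OF h] set_lebesgue_integral_eq_integral(1) in blast)+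
          with elim show "dist (integral {1..real N + 1} (f s)) (integral {1..} (f s)) < e"
            by (simp add: sub(3)[OF fs, of N] dist_norm)
        qed
      qed
    qed
    then show "\<exists>d>0. cball z d \<subseteq> UNIV \<and>
        uniform_limit (cball z d) (\<lambda>N s. integral {1..real N + 1} (f s)) (\<lambda>s. integral {1..} (f s)) sequentially"
      by (intro exI[of _ 1]) auto
  qed auto
  then show "(\<lambda>s. integral {1..} (\<lambda>t. of_real t powr (s - 1) * k t)) holomorphic_on UNIV"
    by (simp add: f_def[abs_def])
qed

text \<open>Integrability against every power t^R is read off from the convergence of the full
  Mellin integral at the real point R + 1, without estimating the exponential.\<close>

lemma bose_tail:
  assumes a: "a > 0"
  shows "(\<lambda>t. of_real t powr w * of_real (bose_kernel a t) :: complex) absolutely_integrable_on {1..}"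
    and "(\<lambda>s. integral {1..} (\<lambda>t. of_real t powr (s - 1) * of_real (bose_kernel a t) :: complex)) holomorphic_on UNIV"
proof -
  have cont: "continuous_on {1..} (\<lambda>t. of_real (bose_kernel a t) :: complex)"
    unfolding bose_kernel_def by (intro continuous_intros) auto
  have int: "(\<lambda>t. t powr R * norm (of_real (bose_kernel a t) :: complex)) integrable_on {1..}" if "R > 1" for R
  proof -
    have "(\<lambda>t. of_real t powr (of_real (R + 1) - 1) * of_real (bose_kernel a t) :: complex) absolutely_integrable_on {0<..}"
      using that a by (intro hurwitz_series_integral) auto
    then have "(\<lambda>t. of_real t powr (of_real (R + 1) - 1) * of_real (bose_kernel a t) :: complex) absolutely_integrable_on {1..}"
      by (rule set_integrable_subset) auto
    then have "(\<lambda>t. norm (of_real t powr (of_real (R + 1) - 1) * of_real (bose_kernel a t) :: complex)) integrable_on {1..}"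
      by (simp add: absolutely_integrable_on_def)
    then show ?thesis
    proof (rule integrable_eq)
      fix t :: real assume "t \<in> {1..}"
      then have "norm (of_real t powr (of_real (R + 1) - 1) :: complex) = t powr R"
        by (subst norm_powr_real_powr) auto
      then show "norm (of_real t powr (of_real (R + 1) - 1) * of_real (bose_kernel a t) :: complex)
          = t powr R * norm (of_real (bose_kernel a t) :: complex)"
        by (simp only: norm_mult)
    qed
  qed
  show "(\<lambda>t. of_real t powr w * of_real (bose_kernel a t) :: complex) absolutely_integrable_on {1..}"
    by (rule mellin_tail_holomorphic(1)[OF cont int])
  show "(\<lambda>s. integral {1..} (\<lambda>t. of_real t powr (s - 1) * of_real (bose_kernel a t) :: complex)) holomorphic_on UNIV"
    by (rule mellin_tail_holomorphic(2)[OF cont int])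
qed

section \<open>The continued zeta function and its derivative\<close>

text \<open>\<open>F\<close> shows that the choice in the definition has a witness, and the identity
  theorem on the connected punctured plane makes the chosen function equal to \<open>F\<close>. At 1
  the choice is unconstrained.\<close>

lemma hurwitz_zeta_eqI:
  assumes F: "F holomorphic_on - {1}"
    and sums: "\<And>z. Re z > 1 \<Longrightarrow> (\<lambda>k. of_real (real k + a) powr (- z)) sums F z"
    and s: "s \<noteq> 1"
  shows "hurwitz_zeta s a = F s"
proof -
  define P where "P f \<longleftrightarrow> f holomorphic_on - {1} \<and>
    (\<forall>z. Re z > 1 \<longrightarrow> (\<lambda>k. (of_real (real k + a)) powr (- z)) sums f z)" for f :: "complex \<Rightarrow> complex"
  define Z where "Z = (SOME f. P f)"
  have "P F" using F sums by (simp add: P_def)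
  then have "P Z" unfolding Z_def by (rule someI[of P])
  have "Z s = F s"
  proof (rule analytic_continuation_open[of "{z. Re z > 1}" "- {1}" Z F s])
    show "{z::complex. Re z > 1} \<noteq> {}" by (auto intro!: exI[of _ 2])
    show "connected (- {1::complex})" by (rule connected_punctured_universe) simp
    show "Z z = F z" if "z \<in> {z. Re z > 1}" for z
      using \<open>P Z\<close> that by (intro sums_unique2[OF _ sums]) (auto simp: P_def)
  qed (use \<open>P Z\<close> F s open_halfspace_Re_gt in \<open>auto simp: P_def\<close>)
  then show ?thesis by (simp add: hurwitz_zeta_def Z_def P_def)
qed

text \<open>This is \<open>rGamma s / (s + n - 1)\<close> with its removable singularity at \<open>1 - n\<close>
  filled in for positive \<open>n\<close>.\<close>
fun mellin_moment :: "nat \<Rightarrow> complex \<Rightarrow> complex" where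
  "mellin_moment 0 s = rGamma s / (s - 1)"
| "mellin_moment (Suc n) s = pochhammer s n * rGamma (s + of_nat (Suc n))"

lemma mellin_moment_eq:
  assumes "s + of_nat n \<noteq> 1"
  shows "mellin_moment n s = rGamma s / (s + of_nat n - 1)"
proof (cases n)
  case (Suc k)
  have "rGamma s = pochhammer s k * (s + of_nat k) * rGamma (s + of_nat n)"
    using pochhammer_rGamma[of s n] by (simp add: Suc pochhammer_Suc)
  moreover have "s + of_nat k \<noteq> 0" "s + of_nat n - 1 = s + of_nat k" using assms by (auto simp: Suc)
  ultimately show ?thesis by (simp add: Suc)
qed simp

text \<open>Only the moment for n = 0 has a pole at 1, where \<open>rGamma\<close> equals 1; it is
  the pole of the zeta function.\<close>

lemma mellin_moment_holomorphic: "mellin_moment n holomorphic_on - {1}"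
proof (cases n)
  case 0
  have "(\<lambda>s. rGamma s / (s - 1)) holomorphic_on - {1::complex}" by (intro holomorphic_intros) auto
  then show ?thesis by (simp add: 0 fun_eq_iff cong: holomorphic_cong)
next
  case (Suc k)
  have "(\<lambda>s::complex. pochhammer s k * rGamma (s + of_nat (Suc k))) holomorphic_on - {1}"
    by (intro holomorphic_intros)
  then show ?thesis by (simp add: Suc cong: holomorphic_cong)
qed

text \<open>\<open>rGamma\<close> vanishes at -k, so the quotient rule leaves only rGamma'(-k) =
  (-1)^k k! over the denominator. At n = k + 1 the zero is used up by the pole and the formula
  breaks down.\<close>

lemma deriv_mellin_moment:
  assumes "n \<noteq> k + 1"
  shows "deriv (mellin_moment n) (- of_nat k) = (-1) ^ k * fact k / (of_nat n - of_nat k - 1)"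
proof -
  have 0: "of_nat n - of_nat k - 1 \<noteq> (0::complex)"
    using assms by (metis add_diff_cancel_left' diff_add_eq diff_diff_eq eq_iff_diff_eq_0 of_nat_1 of_nat_add of_nat_eq_iff)
  let ?U = "{s. s + of_nat n - 1 \<noteq> (0::complex)}"
  have "open ?U" by (intro open_Collect_neq continuous_intros)
  have "((\<lambda>s::complex. rGamma s / (s + of_nat n - 1)) has_field_derivative
     (-1) ^ k * fact k / (of_nat n - of_nat k - 1)) (at (- of_nat k))"
  proof -
    have "((\<lambda>s. s + of_nat n - 1) has_field_derivative 1) (at (- of_nat k :: complex))"
      by (auto intro!: derivative_eq_intros)
    moreover have "- of_nat k + of_nat n - 1 = (of_nat n - of_nat k - 1 :: complex)" by simp
    moreover have "rGamma (- of_nat k :: complex) = 0" by (simp add: rGamma_eq_zero_iff)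
    moreover have "(rGamma has_field_derivative (-1) ^ k * fact k) (at (- of_nat k :: complex))"
      by (rule has_field_derivative_rGamma_nonpos_int)
    ultimately show ?thesis
      using DERIV_divide[of rGamma "(-1) ^ k * fact k" "- of_nat k :: complex" UNIV "\<lambda>s. s + of_nat n - 1" 1] 0
      by simp
  qed
  then have "(mellin_moment n has_field_derivative
     (-1) ^ k * fact k / (of_nat n - of_nat k - 1)) (at (- of_nat k))"
    by (rule has_field_derivative_transform_within_open[OF _ \<open>open ?U\<close>])
       (use 0 in \<open>auto simp: mellin_moment_eq algebra_simps\<close>)
  then show ?thesis by (rule DERIV_imp_deriv)
qed

text \<open>The series of moments converges locally uniformly off 1 together with its derivatives,
  and adding \<open>rGamma s * J s\<close> continues the zeta function. At -k the factor
  \<open>rGamma\<close> vanishes, so of the second summand only rGamma'(-k) J(-k) survives.\<close>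

lemma hurwitz_zeta'_eq:
  fixes d :: "nat \<Rightarrow> complex"
  assumes a: "a > 0" and d: "summable (\<lambda>n. norm (d n))"
    and ps: "\<And>t. t \<in> {0<..1} \<Longrightarrow> (\<lambda>n. d n * of_real t ^ n) sums of_real (t * bose_kernel a t)"
  shows "(\<lambda>n. d n * deriv (mellin_moment n) (- of_nat k)) sums
    (hurwitz_zeta' (- of_nat k) a - (-1) ^ k * fact k *
       integral {1..} (\<lambda>t. of_real t powr (- of_nat k - 1) * of_real (bose_kernel a t)))"
proof -
  define J where "J s = integral {1..} (\<lambda>t. of_real t powr (s - 1) * of_real (bose_kernel a t) :: complex)" for s
  have J: "J holomorphic_on UNIV" unfolding J_def by (rule bose_tail(2)[OF a])
  have "\<exists>g g'. \<forall>s\<in>- {1}. (\<lambda>n. d n * mellin_moment n s) sums g s \<and>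
      (\<lambda>n. d n * deriv (mellin_moment n) s) sums g' s \<and> (g has_field_derivative g' s) (at s)"
  proof (rule series_and_derivative_comparison_local)
    show "((\<lambda>s. d n * mellin_moment n s) has_field_derivative d n * deriv (mellin_moment n) s) (at s)"
      if "s \<in> - {1}" for n s
      using mellin_moment_holomorphic that by (intro DERIV_cmult holomorphic_derivI) auto
    fix s :: complex
    have "compact (rGamma ` cball s 1)" by (intro compact_continuous_image continuous_intros) auto
    then have "bounded (rGamma ` cball s 1)" by (rule compact_imp_bounded)
    then obtain B where "\<forall>z\<in>cball s 1. norm (rGamma z) \<le> B" by (auto simp: bounded_iff)
    then have B: "norm (rGamma z) \<le> B" if "z \<in> cball s 1" for z using that by blast
    have "eventually (\<lambda>n. \<forall>z\<in>ball s 1 \<inter> - {1}. norm (d n * mellin_moment n z) \<le> norm (d n) * B) sequentially"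
      using eventually_ge_at_top[of "nat \<lceil>norm s + 3\<rceil>"]
    proof eventually_elim
      case (elim n)
      show ?case
      proof
        fix z assume z: "z \<in> ball s 1 \<inter> - {1}"
        have "norm z \<le> norm s + 1" using z norm_triangle_ineq2[of z s] by (simp add: dist_norm norm_minus_commute)
        moreover have "real n \<ge> norm s + 3" using elim by linarith
        moreover have "norm (of_nat n - 1 :: complex) \<ge> real n - 1"
          using norm_triangle_ineq2[of "of_nat n" "1::complex"] by simp
        moreover have "norm (z + of_nat n - 1) \<ge> norm (of_nat n - 1 :: complex) - norm z"
          using norm_triangle_ineq2[of "of_nat n - 1" "- z"] by (simp add: algebra_simps)
        ultimately have 1: "norm (z + of_nat n - 1) \<ge> 1" by linarith
        then have "z + of_nat n \<noteq> 1" by auto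
        then have "norm (mellin_moment n z) = norm (rGamma z) / norm (z + of_nat n - 1)"
          by (simp add: mellin_moment_eq norm_divide)
        also have "\<dots> \<le> norm (rGamma z) / 1" using 1 by (intro divide_left_mono) auto
        also have "\<dots> \<le> B" using B[of z] z by simp
        finally show "norm (d n * mellin_moment n z) \<le> norm (d n) * B" by (simp add: norm_mult mult_left_mono)
      qed
    qed
    moreover note summable_mult2[OF d, of B]
    ultimately have "0 < (1::real) \<and> summable (\<lambda>n. norm (d n) * B) \<and>
        (\<forall>\<^sub>F n in sequentially. \<forall>y\<in>ball s 1 \<inter> - {1}. norm (d n * mellin_moment n y) \<le> norm (d n) * B)"
      by simp
    then show "\<exists>r h. 0 < r \<and> summable h \<and>
        (\<forall>\<^sub>F n in sequentially. \<forall>y\<in>ball s r \<inter> - {1}. norm (d n * mellin_moment n y) \<le> h n)"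
      by blast
  qed (simp add: open_Compl)
  then obtain g g' where gg': "\<forall>s\<in>- {1}. (\<lambda>n. d n * mellin_moment n s) sums g s \<and>
      (\<lambda>n. d n * deriv (mellin_moment n) s) sums g' s \<and> (g has_field_derivative g' s) (at s)"
    by (elim exE)
  then have g: "(\<lambda>n. d n * mellin_moment n s) sums g s"
    and g': "(\<lambda>n. d n * deriv (mellin_moment n) s) sums g' s"
    and Dg: "(g has_field_derivative g' s) (at s)" if "s \<noteq> 1" for s
    using that by auto
  have sums: "(\<lambda>k. of_real (real k + a) powr (- s)) sums (g s + rGamma s * J s)" if s: "Re s > 1" for s
  proof -
    let ?f = "\<lambda>t. of_real t powr (s - 1) * of_real (bose_kernel a t) :: complex"
    have int: "?f absolutely_integrable_on {0<..}" by (rule hurwitz_series_integral[OF s a])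
    have int1: "?f absolutely_integrable_on {0<..1}" and int2: "?f absolutely_integrable_on {1..}"
      by (auto intro: set_integrable_subset[OF int])
    have "(?f has_integral (integral {0<..1} ?f + integral {1..} ?f)) ({0<..1} \<union> {1..})"
      using int1 int2 set_lebesgue_integral_eq_integral(1)
      by (intro has_integral_Un integrable_integral) (auto intro: negligible_subset[of "{1}"])
    also have "{0<..1} \<union> {1..} = ({0<..} :: real set)" by auto
    finally have split: "integral {0<..} ?f = integral {0<..1} ?f + J s" by (auto simp: J_def)
    \<comment> \<open>The exponent is s - 2 because the power series expands t times the
      kernel.\<close>
    have "(\<lambda>n. d n / (s - 2 + of_nat n + 1)) sums
        integral {0<..1} (\<lambda>t. of_real t powr (s - 2) * of_real (t * bose_kernel a t))"
      using s by (intro power_series_integral d ps) auto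
    also have "integral {0<..1} (\<lambda>t. of_real t powr (s - 2) * of_real (t * bose_kernel a t)) = integral {0<..1} ?f"
    proof (rule integral_cong)
      fix t :: real assume "t \<in> {0<..1}"
      then have "complex_of_real t powr (s - 1) = of_real t powr (s - 2) * of_real t"
        using powr_add[of "complex_of_real t" "s - 2" 1] by simp
      then show "of_real t powr (s - 2) * of_real (t * bose_kernel a t) = ?f t" by simp
    qed
    finally have "(\<lambda>n. rGamma s * (d n / (s - 2 + of_nat n + 1))) sums (rGamma s * integral {0<..1} ?f)"
      by (rule sums_mult)
    also have "(\<lambda>n. rGamma s * (d n / (s - 2 + of_nat n + 1))) = (\<lambda>n. d n * mellin_moment n s)"
    proof
      fix n
      have "Re (s + of_nat n) > 1" using s by simp
      then have "s + of_nat n \<noteq> 1" by (metis less_irrefl one_complex.sel(1))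
      then show "rGamma s * (d n / (s - 2 + of_nat n + 1)) = d n * mellin_moment n s"
        by (simp add: mellin_moment_eq)
    qed
    finally have "g s = rGamma s * integral {0<..1} ?f"
      using g[of s] s sums_unique2 by force
    with hurwitz_series_integral(2)[OF s a] show ?thesis by (simp add: split distrib_left)
  qed
  have hol: "(\<lambda>s. g s + rGamma s * J s) holomorphic_on - {1}"
  proof (intro holomorphic_intros holomorphic_on_subset[OF J])
    show "g holomorphic_on - {1}"
      using Dg by (auto simp: holomorphic_on_open open_Compl)
  qed auto
  let ?s = "- of_nat k :: complex"
  have s1: "?s \<noteq> 1" by (metis add.inverse_inverse add.left_neutral add_eq_0_iff of_nat_0_eq_iff of_nat_1 of_nat_Suc of_nat_add plus_1_eq_Suc nat.simps(3))
  have "((\<lambda>s. g s + rGamma s * J s) has_field_derivative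
      g' ?s + ((-1) ^ k * fact k * J ?s + deriv J ?s * rGamma ?s)) (at ?s)"
    by (intro DERIV_add DERIV_mult Dg s1 has_field_derivative_rGamma_nonpos_int holomorphic_derivI[OF J]) auto
  also have "rGamma ?s = 0" by (simp add: rGamma_eq_zero_iff)
  finally have "((\<lambda>s. g s + rGamma s * J s) has_field_derivative g' ?s + (-1) ^ k * fact k * J ?s) (at ?s)"
    by simp
  then have "((\<lambda>s. hurwitz_zeta s a) has_field_derivative g' ?s + (-1) ^ k * fact k * J ?s) (at ?s)"
    by (rule has_field_derivative_transform_within_open[of _ _ _ "- {1}"])
       (use s1 in \<open>auto simp: hurwitz_zeta_eqI[OF hol sums] open_Compl\<close>)
  then have "hurwitz_zeta' ?s a = g' ?s + (-1) ^ k * fact k * J ?s"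
    unfolding hurwitz_zeta'_def by (rule DERIV_imp_deriv)
  with g'[OF s1] show ?thesis by (simp add: J_def)
qed

section \<open>The derivative at negative odd integers\<close>

text \<open>This divides a power series by t^N when the quotient is known merely to be bounded on
  (0,1]. One power is removed at a time: the constant term is at most t times a fixed bound for all
  small t, hence 0.\<close>

lemma power_series_vanishing_order:
  fixes d :: "nat \<Rightarrow> 'a::{real_normed_field,banach}"
  assumes d: "summable (\<lambda>n. norm (d n))"
    and F: "\<And>t::real. t \<in> {0<..1} \<Longrightarrow> (\<lambda>n. d n * of_real t ^ n) sums (of_real t ^ N * F t)"
    and B: "\<And>t. t \<in> {0<..1} \<Longrightarrow> norm (F t) \<le> B"
  shows "(\<forall>n<N. d n = 0) \<and> (\<forall>t\<in>{0<..1}. (\<lambda>n. d (n + N) * of_real t ^ n) sums F t)"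
  using F B
proof (induction N arbitrary: F B)
  case 0
  then show ?case by simp
next
  case (Suc N)
  have IH: "(\<forall>n<N. d n = 0) \<and> (\<forall>t\<in>{0<..1}. (\<lambda>n. d (n + N) * of_real t ^ n) sums (of_real t * F t))"
  proof (rule Suc.IH[of "\<lambda>t. of_real t * F t" B])
    fix t :: real assume t: "t \<in> {0<..1}"
    show "(\<lambda>n. d n * of_real t ^ n) sums (of_real t ^ N * (of_real t * F t))"
      using Suc.prems(1)[OF t] by (simp add: mult_ac)
    have "t * norm (F t) \<le> 1 * B" using t Suc.prems(2)[OF t] by (intro mult_mono) auto
    then show "norm (of_real t * F t) \<le> B" using t by (simp add: norm_mult)
  qed
  define S where "S = (\<Sum>n. norm (d (n + N + 1)))"
  have dS: "summable (\<lambda>n. norm (d (n + N + 1)))"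
    using summable_ignore_initial_segment[OF d, of "N + 1"] by (simp add: add_ac)
  have step: "(\<lambda>n. d (n + N + 1) * of_real t ^ Suc n) sums (of_real t * F t - d N)" if "t \<in> {0<..1}" for t
  proof -
    have "(\<lambda>n. d (n + N) * of_real t ^ n) sums (of_real t * F t)" using IH that by blast
    then show ?thesis
      using sums_Suc_iff[of "\<lambda>n. d (n + N) * of_real t ^ n" "of_real t * F t - d N"] by simp
  qed
  have le: "norm (d N) \<le> t * (S + B)" if t: "t \<in> {0<..1}" for t
  proof -
    have "norm (d (n + N + 1) * of_real t ^ Suc n) \<le> t * norm (d (n + N + 1))" for n
    proof -
      have "norm (d (n + N + 1)) * t ^ n \<le> norm (d (n + N + 1)) * 1"
        using t by (intro mult_left_mono power_le_one) auto
      then have "t * (norm (d (n + N + 1)) * t ^ n) \<le> t * norm (d (n + N + 1))"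
        using t by (intro mult_left_mono) auto
      then show ?thesis using t by (simp add: norm_mult norm_power mult_ac)
    qed
    then have "norm (of_real t * F t - d N) \<le> (\<Sum>n. t * norm (d (n + N + 1)))"
      unfolding sums_unique[OF step[OF t]] by (intro norm_suminf_le summable_mult dS)
    also have "\<dots> = t * S" unfolding S_def by (rule suminf_mult[OF dS])
    finally have 1: "norm (of_real t * F t - d N) \<le> t * S" .
    have "norm (of_real t * F t) \<le> t * B" using t Suc.prems(2)[OF t] by (simp add: norm_mult)
    then show ?thesis using 1 norm_triangle_ineq2[of "d N" "of_real t * F t"]
      by (simp add: norm_minus_commute distrib_left)
  qed
  have dN: "d N = 0"
  proof (rule ccontr)
    assume "d N \<noteq> 0"
    then have pos: "norm (d N) > 0" by simp
    moreover have "norm (d N) \<le> S + B" using le[of 1] by simp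
    ultimately have SB: "S + B > 0" "norm (d N) \<le> S + B" by linarith+
    \<comment> \<open>With this t the estimate \<open>le\<close> would give half of
      \<open>norm (d N)\<close> as a bound for itself; the instance t = 1 shows that t does not
      exceed 1.\<close>
    have "norm (d N) / (2 * (S + B)) \<in> {0<..1}" using pos SB by (simp add: field_simps)
    from le[OF this] have "norm (d N) \<le> norm (d N) / (2 * (S + B)) * (S + B)" .
    also have "x / (2 * y) * y = x / 2" if "y > 0" for x y :: real using that by simp
    from this[OF SB(1)] have "norm (d N) / (2 * (S + B)) * (S + B) = norm (d N) / 2" .
    finally show False using pos by simp
  qed
  have "(\<lambda>n. d (n + Suc N) * of_real t ^ n) sums F t" if "t \<in> {0<..1}" for t
  proof -
    have "(\<lambda>n. of_real t * (d (n + Suc N) * of_real t ^ n)) sums (of_real t * F t)"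
      using step[OF that] dN by (simp add: mult_ac)
    then show ?thesis using that by (subst (asm) sums_mult_iff) auto
  qed
  then show ?case using IH dN less_Suc_eq by auto
qed

lemma has_integral_inverse_quadratic:
  fixes c :: real
  assumes c: "c > 0"
  shows "((\<lambda>t. 1 / (t\<^sup>2 + c\<^sup>2)) has_integral pi / (2 * c)) {0<..}"
proof -
  have pos: "t\<^sup>2 + c\<^sup>2 > 0" for t using c by (simp add: add_nonneg_pos)
  have int: "((\<lambda>t. 1 / (t\<^sup>2 + c\<^sup>2)) has_integral (arctan (y / c) / c)) {0..y}" if "y \<ge> 0" for y
  proof -
    have "((\<lambda>t. arctan (t / c) / c) has_real_derivative 1 / (t\<^sup>2 + c\<^sup>2)) (at t within {0..y})" for t
    proof -
      have "1 + (t / c)\<^sup>2 = (t\<^sup>2 + c\<^sup>2) / c\<^sup>2" using c by (simp add: field_simps)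
      then show ?thesis
        using c pos[of t] by (auto intro!: derivative_eq_intros simp: power2_eq_square)
    qed
    then have "((\<lambda>t. 1 / (t\<^sup>2 + c\<^sup>2)) has_integral (arctan (y / c) / c - arctan (0 / c) / c)) {0..y}"
      using that by (intro fundamental_theorem_of_calculus)
        (auto simp flip: has_real_derivative_iff_has_vector_derivative)
    then show ?thesis by simp
  qed
  have "((\<lambda>t. 1 / (t\<^sup>2 + c\<^sup>2)) has_integral pi / (2 * c)) {0..}"
  proof (rule has_integral_to_inf)
    show "(\<lambda>t. 1 / (t\<^sup>2 + c\<^sup>2)) integrable_on {0..y}" for y
      using int[of y] by (cases "y \<ge> 0") auto
    have "filterlim (\<lambda>y. y * (1 / c)) at_top at_top"
      using c by (intro filterlim_at_top_mult_tendsto_pos[OF tendsto_const] filterlim_ident) auto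
    then have "filterlim (\<lambda>y. y / c) at_top at_top" by simp
    then have "((\<lambda>y. arctan (y / c) / c) \<longlongrightarrow> (pi / 2) / c) at_top"
      using c by (intro tendsto_intros filterlim_compose[OF tendsto_arctan_at_top]) auto
    then have "((\<lambda>y. arctan (y / c) / c) \<longlongrightarrow> pi / (2 * c)) at_top" by simp
    moreover have "eventually (\<lambda>y. arctan (y / c) / c = integral {0..y} (\<lambda>t. 1 / (t\<^sup>2 + c\<^sup>2))) at_top"
      using eventually_ge_at_top[of 0] by eventually_elim (simp add: integral_unique[OF int])
    ultimately show "((\<lambda>y. integral {0..y} (\<lambda>t. 1 / (t\<^sup>2 + c\<^sup>2))) \<longlongrightarrow> pi / (2 * c)) at_top"
      by (rule Lim_transform_eventually)
    show "1 / (y\<^sup>2 + c\<^sup>2) \<ge> 0" for y using pos[of y] by simp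
  qed
  moreover have "((\<lambda>t. 1 / (t\<^sup>2 + c\<^sup>2)) has_integral pi / (2 * c)) {0..} \<longleftrightarrow>
      ((\<lambda>t. 1 / (t\<^sup>2 + c\<^sup>2)) has_integral pi / (2 * c)) {0<..}"
    by (rule has_integral_spike_set_eq) (auto intro: negligible_subset[of "{0}"])
  ultimately show ?thesis by simp
qed

section \<open>The difference of the kernels for a and 1 - a\<close>

text \<open>Multiplied by t this generates (B_n(1-a) - B_n(a)) / n!, which is 0 for even n by the
  reflection formula.\<close>

definition bose_difference :: "real \<Rightarrow> real \<Rightarrow> real"
  where "bose_difference a t = bose_kernel a t - bose_kernel (1 - a) t"

text \<open>The contribution of the poles at plus and minus 2 pi i (n + 1) to the quotient minus its
  Taylor polynomial of degree 2m - 2, stripped of the factor (-1)^m t^(2m).\<close>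

definition bose_remainder :: "nat \<Rightarrow> real \<Rightarrow> real \<Rightarrow> nat \<Rightarrow> real"
  where "bose_remainder m a t n =
    4 * sin (2 * pi * real (Suc n) * a) /
      ((2 * pi * real (Suc n)) ^ (2 * m - 1) * (t\<^sup>2 + (2 * pi * real (Suc n))\<^sup>2))"

lemma bose_difference_sinh:
  assumes "t > 0"
  shows "bose_difference a t = sinh ((1/2 - a) * t) / sinh (t / 2)"
proof -
  have e: "exp (- (a * t)) = exp ((1/2 - a) * t) * exp (- (t/2))"
    "exp (- ((1 - a) * t)) = exp (- ((1/2 - a) * t)) * exp (- (t/2))"
    "exp (- t) = exp (- (t/2)) * exp (- (t/2))" "1 = exp (t/2) * exp (- (t/2))"
    by (simp_all add: algebra_simps flip: exp_add)
  have d: "1 - exp (- t) = (exp (t/2) - exp (- (t/2))) * exp (- (t/2))"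
    by (subst e(3), subst e(4)) (simp only: left_diff_distrib)
  have "bose_difference a t = (exp (- (a * t)) - exp (- ((1 - a) * t))) / (1 - exp (- t))"
    by (simp add: bose_difference_def bose_kernel_def diff_divide_distrib)
  also have "\<dots> = (exp ((1/2 - a) * t) - exp (- ((1/2 - a) * t))) * exp (- (t/2)) /
      ((exp (t/2) - exp (- (t/2))) * exp (- (t/2)))"
    unfolding d e(1,2) by (simp only: left_diff_distrib)
  also have "\<dots> = (exp ((1/2 - a) * t) - exp (- ((1/2 - a) * t))) / (exp (t/2) - exp (- (t/2)))"
    by simp
  also have "\<dots> = sinh ((1/2 - a) * t) / sinh (t / 2)"
  proof -
    have "u / v = (u / 2) / (v / 2)" for u v :: real by simp
    then show ?thesis unfolding sinh_field_def .
  qed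
  finally show ?thesis .
qed

lemma bose_remainder_bound: "\<bar>bose_remainder m a t n\<bar> \<le> 1 / (real (Suc n))\<^sup>2"
proof -
  define c where "c = 2 * pi * real (Suc n)"
  have c: "1 \<le> c" "4 / c\<^sup>2 \<le> 1 / (real (Suc n))\<^sup>2" using two_pi_Suc_bounds[of n] by (simp_all add: c_def)
  have "1 * c\<^sup>2 \<le> c ^ (2 * m - 1) * (t\<^sup>2 + c\<^sup>2)"
    using c(1) by (intro mult_mono one_le_power) auto
  then have "4 * \<bar>sin (c * a)\<bar> / (c ^ (2 * m - 1) * (t\<^sup>2 + c\<^sup>2)) \<le> 4 / c\<^sup>2"
    using c(1) by (intro frac_le) auto
  moreover have "\<bar>bose_remainder m a t n\<bar> = 4 * \<bar>sin (c * a)\<bar> / (c ^ (2 * m - 1) * (t\<^sup>2 + c\<^sup>2))"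
    using c(1) unfolding bose_remainder_def c_def[symmetric] by (simp add: abs_mult)
  ultimately show ?thesis using c(2) by linarith
qed

lemma summable_bose_remainder: "summable (\<lambda>n. \<bar>bose_remainder m a t n\<bar>)" "summable (bose_remainder m a t)"
proof -
  show 1: "summable (\<lambda>n. \<bar>bose_remainder m a t n\<bar>)"
    by (rule summable_comparison_test'[OF summable_inverse_squares_Suc])
       (simp add: bose_remainder_bound del: of_nat_Suc)
  then show "summable (bose_remainder m a t)" by (rule summable_rabs_cancel)
qed

text \<open>Its independence of t provides the bound \<open>B\<close> demanded by
  \<open>power_series_vanishing_order\<close>.\<close>

lemma bose_remainder_suminf_bound:
  "\<bar>\<Sum>n. bose_remainder m a t n\<bar> \<le> (\<Sum>n. 1 / (real (Suc n))\<^sup>2)"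
proof -
  have "\<bar>\<Sum>n. bose_remainder m a t n\<bar> \<le> (\<Sum>n. \<bar>bose_remainder m a t n\<bar>)"
    by (rule summable_rabs[OF summable_bose_remainder(1)])
  also have "\<dots> \<le> (\<Sum>n. 1 / (real (Suc n))\<^sup>2)"
    by (intro suminf_le bose_remainder_bound summable_bose_remainder summable_inverse_squares_Suc)
  finally show ?thesis .
qed

text \<open>Induction from the partial fractions at m = 1: the identity 1 / (t^2 + c^2) = 1 / c^2 -
  t^2 / (c^2 (t^2 + c^2)) splits off one more Taylor coefficient, namely the remainder series at t =
  0 up to sign.\<close>

lemma bose_difference_expansion:
  assumes a: "0 \<le> a" "a \<le> 1" and m: "m > 0"
  shows "\<exists>e. \<forall>t>0. bose_difference a t =
    (\<Sum>j<m. e j * t ^ (2 * j)) + (-1) ^ m * t ^ (2 * m) * (\<Sum>n. bose_remainder m a t n)"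
  using m
proof (induction m rule: nat_induct_non_zero)
  case 1
  have "bose_difference a t = 1 - 2 * a - t\<^sup>2 * (\<Sum>n. bose_remainder 1 a t n)" if t: "t > 0" for t
  proof -
    have "(\<Sum>n. bose_remainder 1 a t n) = (1 - 2 * a - sinh ((1/2 - a) * t) / sinh (t / 2)) / t\<^sup>2"
      using sinh_quotient_partial_fractions[OF t a] by (simp add: bose_remainder_def sums_iff)
    then show ?thesis using t by (simp add: bose_difference_sinh)
  qed
  then show ?case by (intro exI[of _ "\<lambda>_. 1 - 2 * a"]) (simp add: power2_eq_square)
next
  case (Suc m)
  obtain e where e: "\<And>t. t > 0 \<Longrightarrow> bose_difference a t =
    (\<Sum>j<m. e j * t ^ (2 * j)) + (-1) ^ m * t ^ (2 * m) * (\<Sum>n. bose_remainder m a t n)"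
    using Suc.IH by blast
  define \<epsilon> where "\<epsilon> = (\<Sum>n. bose_remainder m a 0 n)"
  have "(\<Sum>n. bose_remainder m a t n) = \<epsilon> - t\<^sup>2 * (\<Sum>n. bose_remainder (Suc m) a t n)" if t: "t > 0" for t
  proof -
    have "bose_remainder m a t n = bose_remainder m a 0 n - t\<^sup>2 * bose_remainder (Suc m) a t n" for n
    proof -
      define c where "c = 2 * pi * real (Suc n)"
      have c: "c > 0" by (simp add: c_def)
      have p: "c ^ (2 * Suc m - 1) = c ^ (2 * m - 1) * c\<^sup>2"
        using Suc.hyps by (simp flip: power_add)
      have nz: "t\<^sup>2 + c\<^sup>2 \<noteq> 0" "c\<^sup>2 \<noteq> 0" "c ^ (2 * m - 1) \<noteq> 0" using c by (auto simp: add_nonneg_eq_0_iff)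
      show ?thesis
        unfolding bose_remainder_def c_def[symmetric] p using nz
        by (simp add: divide_simps) (simp add: algebra_simps)
    qed
    then have "bose_remainder m a t = (\<lambda>n. bose_remainder m a 0 n - t\<^sup>2 * bose_remainder (Suc m) a t n)"
      by blast
    then show ?thesis
      unfolding \<epsilon>_def using summable_bose_remainder(2)
      by (simp add: suminf_diff[symmetric] suminf_mult[symmetric] summable_mult)
  qed
  note rec = this
  show ?case
  proof (intro exI allI impI)
    fix t :: real assume t: "t > 0"
    have "(\<Sum>j<m. (e(m := (-1) ^ m * \<epsilon>)) j * t ^ (2 * j)) = (\<Sum>j<m. e j * t ^ (2 * j))"
      by (intro sum.cong) auto
    then show "bose_difference a t = (\<Sum>j<Suc m. (e(m := (-1) ^ m * \<epsilon>)) j * t ^ (2 * j)) +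
        (-1) ^ Suc m * t ^ (2 * Suc m) * (\<Sum>n. bose_remainder (Suc m) a t n)"
      unfolding e[OF t] rec[OF t] by (simp add: algebra_simps power2_eq_square)
  qed
qed

text \<open>1 / (t^2 + c^2) integrates to pi / (2c), and 4 / c^(2m-1) times this is 2 pi / c^(2m),
  which is summable over the poles.\<close>

lemma bose_remainder_integral:
  assumes m: "m > 0"
  shows "(\<lambda>t. \<Sum>n. bose_remainder m a t n) absolutely_integrable_on {0<..}"
    and "(\<lambda>n. 2 * pi * sin (2 * pi * real (Suc n) * a) / (2 * pi * real (Suc n)) ^ (2 * m)) sums
      integral {0<..} (\<lambda>t. \<Sum>n. bose_remainder m a t n)"
proof -
  define c where "c n = 2 * pi * real (Suc n)" for n
  have c: "1 \<le> c n" "4 / (c n)\<^sup>2 \<le> 1 / (real (Suc n))\<^sup>2" for n using two_pi_Suc_bounds[of n] by (simp_all add: c_def)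
  have c0: "c n > 0" for n using c(1)[of n] by linarith
  have pw: "c n ^ (2 * m) = c n * c n ^ (2 * m - 1)" for n
    using m by (metis Suc_diff_1 nat_0_less_mult_iff pos2 power_Suc)
  have int: "((\<lambda>t. 4 * y / (c n ^ (2 * m - 1) * (t\<^sup>2 + (c n)\<^sup>2))) has_integral 2 * pi * y / c n ^ (2 * m)) {0<..}" for n y
    using has_integral_mult_right[OF has_integral_inverse_quadratic[OF c0[of n]], of "4 * y / c n ^ (2 * m - 1)"]
    by (simp add: pw mult.assoc)
  have f: "((\<lambda>t. bose_remainder m a t n) has_integral 2 * pi * sin (c n * a) / c n ^ (2 * m)) {0<..}" for n
    unfolding bose_remainder_def c_def[symmetric] by (rule int)
  have "norm (bose_remainder m a t n) = 4 * \<bar>sin (c n * a)\<bar> / (c n ^ (2 * m - 1) * (t\<^sup>2 + (c n)\<^sup>2))" for t n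
    unfolding bose_remainder_def c_def[symmetric] using c0[of n] by (simp add: abs_mult)
  then have K: "((\<lambda>t. norm (bose_remainder m a t n)) has_integral 2 * pi * \<bar>sin (c n * a)\<bar> / c n ^ (2 * m)) {0<..}" for n
    using int[of "\<bar>sin (c n * a)\<bar>" n] by simp
  have sumK: "summable (\<lambda>n. 2 * pi * \<bar>sin (c n * a)\<bar> / c n ^ (2 * m))"
  proof (rule summable_comparison_test'[OF summable_mult[OF summable_inverse_squares_Suc, of "2 * pi"]])
    fix n
    have "(c n)\<^sup>2 \<le> c n ^ (2 * m)" using c(1)[of n] m by (intro power_increasing) auto
    then have "\<bar>sin (c n * a)\<bar> / c n ^ (2 * m) \<le> 4 / (c n)\<^sup>2"
      using c0[of n] by (intro frac_le) (auto intro: order_trans[OF abs_sin_le_one])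
    with c(2)[of n] have "\<bar>sin (c n * a)\<bar> / c n ^ (2 * m) \<le> 1 / (real (Suc n))\<^sup>2" by linarith
    then have "2 * pi * (\<bar>sin (c n * a)\<bar> / c n ^ (2 * m)) \<le> 2 * pi * (1 / (real (Suc n))\<^sup>2)"
      by (intro mult_left_mono) auto
    then show "norm (2 * pi * \<bar>sin (c n * a)\<bar> / c n ^ (2 * m)) \<le> 2 * pi * (1 / (real (Suc n))\<^sup>2)"
      using c0[of n] by simp
  qed
  have abs: "summable (\<lambda>n. norm (bose_remainder m a t n))" for t
    using summable_bose_remainder(1) by simp
  have lim: "bose_remainder m a t sums (\<Sum>n. bose_remainder m a t n)" for t
    by (rule summable_sums[OF summable_bose_remainder(2)])
  show "(\<lambda>t. \<Sum>n. bose_remainder m a t n) absolutely_integrable_on {0<..}"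
    by (rule has_integral_sums(1)[OF f K sumK abs lim])
  show "(\<lambda>n. 2 * pi * sin (2 * pi * real (Suc n) * a) / (2 * pi * real (Suc n)) ^ (2 * m)) sums
      integral {0<..} (\<lambda>t. \<Sum>n. bose_remainder m a t n)"
    using has_integral_sums(2)[OF f K sumK abs lim] by (simp add: c_def)
qed

text \<open>In the second claim the summand with \<open>n = 2 * m\<close> is \<open>0 / 0 = 0\<close>.\<close>
lemma bose_difference_moments:
  assumes a: "0 < a" "a < 1" and m: "m > 0"
    and d: "summable (\<lambda>n. norm (d n :: complex))"
    and ps: "\<And>t. t \<in> {0<..1} \<Longrightarrow> (\<lambda>n. d n * of_real t ^ n) sums of_real (t * bose_difference a t)"
  shows "d (2 * m) = 0"
    and "(\<lambda>n. d n / (of_nat n - of_nat (2 * m))) sums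
      (of_real ((-1) ^ m * integral {0<..} (\<lambda>t. \<Sum>n. bose_remainder m a t n))
       - integral {1..} (\<lambda>t. of_real t powr (- of_nat (2 * m)) * of_real (bose_difference a t)))"
proof -
  define Q where "Q t = (\<Sum>n. bose_remainder m a t n)" for t
  obtain e where e: "\<And>t. t > 0 \<Longrightarrow> bose_difference a t =
    (\<Sum>j<m. e j * t ^ (2 * j)) + (-1) ^ m * t ^ (2 * m) * Q t"
    using bose_difference_expansion[of a m] a m by (auto simp: Q_def)
  define N where "N = 2 * m + 1"
  \<comment> \<open>The coefficients of t times the Taylor polynomial: e_j belongs to the odd power
    2j + 1, and \<open>N\<close> is the order of t times the remainder.\<close>
  define p where "p n = (if n < N \<and> odd n then of_real (e (n div 2)) else 0 :: complex)" for n
  have p0: "p n = 0" if "n \<ge> N" for n using that by (simp add: p_def)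
  have psum: "(\<Sum>n<N. p n * g n) = (\<Sum>j<m. of_real (e j) * g (2 * j + 1))" for g :: "nat \<Rightarrow> complex"
  proof -
    have "(\<Sum>j<m. of_real (e j) * g (2 * j + 1)) = (\<Sum>n\<in>(\<lambda>j. 2 * j + 1) ` {..<m}. of_real (e (n div 2)) * g n)"
      by (subst sum.reindex) (auto simp: inj_on_def)
    also have "(\<lambda>j. 2 * j + 1) ` {..<m} = {n. n < N \<and> odd n}"
      by (auto simp: N_def elim!: oddE)
    also have "(\<Sum>n | n < N \<and> odd n. of_real (e (n div 2)) * g n) = (\<Sum>n<N. p n * g n)"
      by (rule sum.mono_neutral_cong_left) (auto simp: p_def)
    finally show ?thesis ..
  qed
  define D where "D n = d n - p n" for n
  have D: "summable (\<lambda>n. norm (D n))"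
  proof (rule summable_comparison_test_ev[OF _ d])
    show "eventually (\<lambda>n. norm (norm (D n)) \<le> norm (d n)) sequentially"
      using eventually_ge_at_top[of N] by eventually_elim (simp add: D_def p0)
  qed
  \<comment> \<open>Comparing the two expansions gives d = p below \<open>N\<close>, so d(2m) is 0
    by parity, and turns the remainder into a power series that can be integrated over
    (0,1].\<close>
  have "(\<forall>n<N. D n = 0) \<and> (\<forall>t\<in>{0<..1}. (\<lambda>n. D (n + N) * of_real t ^ n) sums of_real ((-1) ^ m * Q t))"
  proof (rule power_series_vanishing_order[OF D])
    fix t :: real assume t: "t \<in> {0<..1}"
    have "(\<lambda>n. p n * of_real t ^ n) sums (\<Sum>n<N. p n * of_real t ^ n)"
      by (rule sums_finite) (auto simp: p0)
    from sums_diff[OF ps[OF t] this]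
    have "(\<lambda>n. D n * of_real t ^ n) sums
        (of_real (t * bose_difference a t) - (\<Sum>j<m. of_real (e j) * of_real t ^ (2 * j + 1)))"
      unfolding psum by (simp add: D_def left_diff_distrib)
    also have "of_real (t * bose_difference a t) - (\<Sum>j<m. of_real (e j) * of_real t ^ (2 * j + 1))
        = (of_real t ^ N * of_real ((-1) ^ m * Q t) :: complex)"
      using t by (simp add: e N_def distrib_left sum_distrib_left mult_ac)
    finally show "(\<lambda>n. D n * of_real t ^ n) sums (of_real t ^ N * of_real ((-1) ^ m * Q t))" .
    show "norm (of_real ((-1) ^ m * Q t) :: complex) \<le> (\<Sum>n. 1 / (real (Suc n))\<^sup>2)"
      using bose_remainder_suminf_bound[of m a t] by (simp add: norm_mult norm_power Q_def)
  qed
  then have D0: "\<And>n. n < N \<Longrightarrow> D n = 0"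
    and DN: "\<And>t. t \<in> {0<..1} \<Longrightarrow> (\<lambda>n. D (n + N) * of_real t ^ n) sums of_real ((-1) ^ m * Q t)"
    by auto
  have dp: "d n = p n" if "n < N" for n using D0[OF that] by (simp add: D_def)
  then show "d (2 * m) = 0" by (simp add: N_def p_def)

  have Q: "Q absolutely_integrable_on {0<..}"
    unfolding Q_def by (rule bose_remainder_integral(1)[OF m])
  have Q1: "Q integrable_on {0<..1}" and Q2: "Q integrable_on {1..}"
    by (auto intro!: set_lebesgue_integral_eq_integral(1) set_integrable_subset[OF Q])
  have "(Q has_integral (integral {0<..1} Q + integral {1..} Q)) ({0<..1} \<union> {1..})"
    using Q1 Q2 by (intro has_integral_Un integrable_integral) (auto intro: negligible_subset[of "{1}"])
  also have "{0<..1} \<union> {1..} = ({0<..} :: real set)" by auto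
  finally have split: "integral {0<..} Q = integral {0<..1} Q + integral {1..} Q" by (rule integral_unique)

  \<comment> \<open>Here n + 1 = (n + N) - 2m, so the integral produces exactly the denominators of
    the claim.\<close>
  have "(\<lambda>n. D (n + N) / (0 + of_nat n + 1)) sums
      integral {0<..1} (\<lambda>t. of_real t powr 0 * of_real ((-1) ^ m * Q t))"
    using summable_ignore_initial_segment[OF D, of N] DN by (intro power_series_integral) auto
  also have "integral {0<..1} (\<lambda>t. of_real t powr 0 * of_real ((-1) ^ m * Q t) :: complex) =
      integral {0<..1} (\<lambda>t. of_real ((-1) ^ m * Q t))"
    by (rule integral_cong) simp
  also have "\<dots> = of_real ((-1) ^ m * integral {0<..1} Q)"
    using has_integral_of_real[OF has_integral_mult_right[OF integrable_integral[OF Q1], of "(-1) ^ m"]]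
    by (rule integral_unique)
  finally have "(\<lambda>n. d (n + N) / (of_nat (n + N) - of_nat (2 * m))) sums of_real ((-1) ^ m * integral {0<..1} Q)"
    by (simp add: D_def p0 N_def add_ac)
  then have lhs: "(\<lambda>n. d n / (of_nat n - of_nat (2 * m))) sums
      (of_real ((-1) ^ m * integral {0<..1} Q) + (\<Sum>n<N. d n / (of_nat n - of_nat (2 * m))))"
    by (subst (asm) sums_iff_shift) simp
  have fin: "(\<Sum>n<N. d n / (of_nat n - of_nat (2 * m))) =
      (\<Sum>j<m. of_real (e j) * (1 / (of_nat (2 * j + 1) - of_nat (2 * m))))"
    using psum[of "\<lambda>n. 1 / (of_nat n - of_nat (2 * m))"] by (simp add: dp)

  \<comment> \<open>Since j < m the exponent is at most -2, which makes the monomial integrable at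
    infinity.\<close>
  have mono: "((\<lambda>t. e j * t powr (2 * real j - 2 * real m)) has_integral e j * (1 / (2 * real m - 2 * real j - 1))) {1..}"
    if j: "j < m" for j
  proof -
    have "((\<lambda>t. 1 / t ^ (2 * (m - j))) has_integral 1 / (real (2 * (m - j) - 1) * 1 ^ (2 * (m - j) - 1))) {1..}"
      using j by (intro has_integral_inverse_power_to_inf) auto
    then have "((\<lambda>t. e j * (1 / t ^ (2 * (m - j)))) has_integral e j * (1 / (2 * real m - 2 * real j - 1))) {1..}"
      using j by (intro has_integral_mult_right) (simp add: of_nat_diff algebra_simps)
    then show ?thesis
    proof (rule has_integral_eq[rotated])
      fix t :: real assume "t \<in> {1..}"
      then have "1 / t ^ (2 * (m - j)) = t powr (- real (2 * (m - j)))"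
        by (simp add: powr_minus powr_realpow divide_inverse del: of_nat_mult)
      then show "e j * (1 / t ^ (2 * (m - j))) = e j * t powr (2 * real j - 2 * real m)"
        using j by (simp add: of_nat_diff algebra_simps)
    qed
  qed
  have sum: "((\<lambda>t. \<Sum>j<m. e j * t powr (2 * real j - 2 * real m)) has_integral
      (\<Sum>j<m. e j * (1 / (2 * real m - 2 * real j - 1)))) {1..}"
    by (intro has_integral_sum mono) auto
  have rem: "((\<lambda>t. (-1) ^ m * Q t) has_integral (-1) ^ m * integral {1..} Q) {1..}"
    by (intro has_integral_mult_right integrable_integral Q2)
  from has_integral_of_real[OF has_integral_add[OF sum rem]]
  have "((\<lambda>t. of_real t powr (- of_nat (2 * m)) * of_real (bose_difference a t)) has_integral
      complex_of_real ((\<Sum>j<m. e j * (1 / (2 * real m - 2 * real j - 1))) + (-1) ^ m * integral {1..} Q)) {1..}"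
  proof (rule has_integral_eq[rotated])
    fix t :: real assume t: "t \<in> {1..}"
    have "t powr (2 * real j - 2 * real m) = t powr (- real (2 * m)) * t ^ (2 * j)" for j
      using t by (simp add: powr_realpow[symmetric] flip: powr_add)
    moreover have "t powr (- real (2 * m)) * t ^ (2 * m) = 1"
      using t by (simp add: powr_realpow[symmetric] flip: powr_add)
    ultimately have "(\<Sum>j<m. e j * t powr (2 * real j - 2 * real m)) + (-1) ^ m * Q t
        = t powr (- real (2 * m)) * bose_difference a t"
      using t by (simp add: e distrib_left sum_distrib_left mult_ac)
    moreover have "complex_of_real (t powr (- real (2 * m))) = of_real t powr (- of_nat (2 * m))"
      using t by (subst powr_of_real[symmetric]) auto
    ultimately show "complex_of_real ((\<Sum>j<m. e j * t powr (2 * real j - 2 * real m)) + (-1) ^ m * Q t) =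
        of_real t powr (- of_nat (2 * m)) * of_real (bose_difference a t)"
      by (simp only: of_real_mult)
  qed
  then have tail: "integral {1..} (\<lambda>t. of_real t powr (- of_nat (2 * m)) * complex_of_real (bose_difference a t)) =
      (\<Sum>j<m. of_real (e j) * (1 / (of_nat (2 * m) - of_nat (2 * j + 1)))) + of_real ((-1) ^ m * integral {1..} Q)"
    by (simp add: integral_unique diff_diff_add add.commute)
  \<comment> \<open>The monomials contribute opposite amounts on the two sides of t = 1, so only the
    integral of \<open>Q\<close> over (0,oo) remains.\<close>
  have "(\<Sum>j<m. of_real (e j) * (1 / (of_nat (2 * j + 1) - of_nat (2 * m)))) =
      - (\<Sum>j<m. of_real (e j) * (1 / (of_nat (2 * m) - of_nat (2 * j + 1))) :: complex)"
    unfolding sum_negf[symmetric] by (intro sum.cong refl) (metis minus_diff_eq minus_divide_right mult_minus_right)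
  with lhs show "(\<lambda>n. d n / (of_nat n - of_nat (2 * m))) sums
      (of_real ((-1) ^ m * integral {0<..} (\<lambda>t. \<Sum>n. bose_remainder m a t n))
       - integral {1..} (\<lambda>t. of_real t powr (- of_nat (2 * m)) * of_real (bose_difference a t)))"
    unfolding fin tail Q_def[symmetric] split by (simp add: distrib_left algebra_simps)
qed

section \<open>From zeta derivatives to sine series\<close>

text \<open>Subtracting the derivative formulas for a and 1 - a gives the moment series of the
  kernel difference, evaluated independently by \<open>bose_difference_moments\<close>. The
  integrals over [1,oo) occur on both sides and cancel.\<close>

lemma sin_series_hurwitz_zeta':
  assumes a: "0 < a" "a < 1" and m: "m > 0"
  shows "(\<lambda>n. complex_of_real (sin (2 * pi * real (Suc n) * a) / real (Suc n) ^ (2 * m))) sums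
    (of_real ((-1) ^ m * (2 * pi) ^ (2 * m - 1) / fact (2 * m - 1)) *
      (hurwitz_zeta' (- of_nat (2 * m - 1)) (1 - a) - hurwitz_zeta' (- of_nat (2 * m - 1)) a))"
proof -
  define k where "k = 2 * m - 1"
  have k: "2 * m = k + 1" "odd k" using m by (auto simp: k_def)
  have exponent: "- of_nat k - 1 = (- of_nat (2 * m) :: complex)" by (simp add: k(1))
  define J where "J b = integral {1..} (\<lambda>t. of_real t powr (- of_nat (2 * m)) * of_real (bose_kernel b t) :: complex)" for b
  define q where "q = integral {0<..} (\<lambda>t. \<Sum>n. bose_remainder m a t n)"
  have a': "1 - a > 0" using a by simp
  obtain d1 :: "nat \<Rightarrow> complex" where d1: "summable (\<lambda>n. norm (d1 n))"
    "\<And>t. t \<in> {0<..1} \<Longrightarrow> (\<lambda>n. d1 n * of_real t ^ n) sums of_real (t * bose_kernel a t)"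
    using bose_power_series[of a] by blast
  obtain d2 :: "nat \<Rightarrow> complex" where d2: "summable (\<lambda>n. norm (d2 n))"
    "\<And>t. t \<in> {0<..1} \<Longrightarrow> (\<lambda>n. d2 n * of_real t ^ n) sums of_real (t * bose_kernel (1 - a) t)"
    using bose_power_series[of "1 - a"] by blast
  define d where "d n = d1 n - d2 n" for n
  have d: "summable (\<lambda>n. norm (d n))"
    by (rule summable_comparison_test'[OF summable_add[OF d1(1) d2(1)]]) (simp add: d_def norm_triangle_ineq4)
  have ps: "(\<lambda>n. d n * of_real t ^ n) sums of_real (t * bose_difference a t)" if "t \<in> {0<..1}" for t
    using sums_diff[OF d1(2)[OF that] d2(2)[OF that]]
    by (simp add: d_def bose_difference_def left_diff_distrib right_diff_distrib)
  have d0: "d (2 * m) = 0" by (rule bose_difference_moments(1)[OF a m d ps])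
  \<comment> \<open>This sign is why the derivative at a is subtracted from the one at 1 - a in the
    result.\<close>
  have C: "(-1) ^ k * fact k = (- fact k :: complex)" using k(2) by simp
  have "integral {1..} (\<lambda>t. of_real t powr (- of_nat (2 * m)) * complex_of_real (bose_difference a t)) = J a - J (1 - a)"
  proof -
    have "((\<lambda>t. of_real t powr (- of_nat (2 * m)) * of_real (bose_kernel b t) :: complex) has_integral J b) {1..}"
      if "b > 0" for b
      unfolding J_def
      using bose_tail(1)[OF that] set_lebesgue_integral_eq_integral(1) by (intro integrable_integral) blast
    from has_integral_diff[OF this[OF a(1)] this[OF a']] show ?thesis
      by (intro integral_unique) (simp add: bose_difference_def right_diff_distrib)
  qed
  with bose_difference_moments(2)[OF a m d ps]
  have "(\<lambda>n. d n / (of_nat n - of_nat (2 * m))) sums (of_real ((-1) ^ m * q) - (J a - J (1 - a)))"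
    by (simp only: q_def)
  then have "(\<lambda>n. (-1) ^ k * fact k * (d n / (of_nat n - of_nat (2 * m)))) sums
      ((-1) ^ k * fact k * (of_real ((-1) ^ m * q) - (J a - J (1 - a))))"
    by (rule sums_mult)
  also have "(\<lambda>n. (-1) ^ k * fact k * (d n / (of_nat n - of_nat (2 * m)))) =
      (\<lambda>n. d n * deriv (mellin_moment n) (- of_nat k))"
  proof
    fix n
    show "(-1) ^ k * fact k * (d n / (of_nat n - of_nat (2 * m))) = d n * deriv (mellin_moment n) (- of_nat k)"
    proof (cases "n = 2 * m")
      case True
      then show ?thesis using d0 by simp
    next
      case False
      then show ?thesis by (simp add: deriv_mellin_moment k(1) diff_diff_add add.commute)
    qed
  qed
  finally have "(\<lambda>n. d n * deriv (mellin_moment n) (- of_nat k)) sums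
      ((-1) ^ k * fact k * (of_real ((-1) ^ m * q) - (J a - J (1 - a))))" .
  moreover have "(\<lambda>n. d n * deriv (mellin_moment n) (- of_nat k)) sums
      ((hurwitz_zeta' (- of_nat k) a - (-1) ^ k * fact k * J a) -
       (hurwitz_zeta' (- of_nat k) (1 - a) - (-1) ^ k * fact k * J (1 - a)))"
    using sums_diff[OF hurwitz_zeta'_eq[OF a(1) d1, of k] hurwitz_zeta'_eq[OF a' d2, of k]]
    unfolding exponent J_def by (simp add: d_def left_diff_distrib)
  ultimately have "(-1) ^ k * fact k * (of_real ((-1) ^ m * q) - (J a - J (1 - a))) =
      (hurwitz_zeta' (- of_nat k) a - (-1) ^ k * fact k * J a) -
       (hurwitz_zeta' (- of_nat k) (1 - a) - (-1) ^ k * fact k * J (1 - a))"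
    by (rule sums_unique2)
  then have diff: "hurwitz_zeta' (- of_nat k) (1 - a) - hurwitz_zeta' (- of_nat k) a =
      fact k * of_real ((-1) ^ m * q)"
    unfolding C by (simp add: algebra_simps)
  have "(\<lambda>n. (2 * pi) ^ k * (2 * pi * sin (2 * pi * real (Suc n) * a) / (2 * pi * real (Suc n)) ^ (2 * m))) sums
      ((2 * pi) ^ k * q)"
    unfolding q_def by (intro sums_mult bose_remainder_integral(2)[OF m])
  also have "(\<lambda>n. (2 * pi) ^ k * (2 * pi * sin (2 * pi * real (Suc n) * a) / (2 * pi * real (Suc n)) ^ (2 * m))) =
      (\<lambda>n. sin (2 * pi * real (Suc n) * a) / real (Suc n) ^ (2 * m))"
    by (rule ext) (simp add: k(1) power_mult_distrib del: of_nat_Suc)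
  finally have "(\<lambda>n. complex_of_real (sin (2 * pi * real (Suc n) * a) / real (Suc n) ^ (2 * m))) sums
      of_real ((2 * pi) ^ k * q)"
    by (rule sums_of_real)
  also have "of_real ((2 * pi) ^ k * q) =
      of_real ((-1) ^ m * (2 * pi) ^ k / fact k) * (fact k * complex_of_real ((-1) ^ m * q))"
  proof -
    have "(-1) ^ m * (2 * pi) ^ k / fact k * (fact k * ((-1) ^ m * q)) = ((-1) ^ m * (-1) ^ m) * ((2 * pi) ^ k * q)"
      by simp
    also have "(-1) ^ m * (-1) ^ m = (1 :: real)" by (simp flip: power_add)
    finally have "(2 * pi) ^ k * q = (-1) ^ m * (2 * pi) ^ k / fact k * (fact k * ((-1) ^ m * q))"
      by (simp only: mult_1)
    then have "complex_of_real ((2 * pi) ^ k * q) =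
        of_real ((-1) ^ m * (2 * pi) ^ k / fact k * (fact k * ((-1) ^ m * q)))"
      by (rule arg_cong)
    also have "\<dots> = of_real ((-1) ^ m * (2 * pi) ^ k / fact k) * (fact k * complex_of_real ((-1) ^ m * q))"
      by (simp only: of_real_mult of_real_fact)
    finally show ?thesis .
  qed
  finally show ?thesis unfolding k_def[symmetric] diff .
qed

text \<open>The terms of even index sum to 2^(-2m) times the series at 2x, so twice that is 2^(1-2m)
  times it. This cancels the 2^(2m-1) in front of the derivatives at x / pi and 1 - x / pi; x < pi
  keeps 2x inside the period.\<close>

theorem mainTheorem3:
  fixes m :: nat and x :: real
  assumes "m > 0" and "0 < x" and "x < pi"
  shows "(\<lambda>n. complex_of_real ((-1) ^ n * sin (real (Suc n) * x) / real (Suc n) ^ (2 * m)))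
    sums (of_real ((-1) ^ m * pi ^ (2 * m - 1) / fact (2 * m - 1)) *
      (2 ^ (2 * m - 1) * hurwitz_zeta' (of_int (1 - 2 * int m)) (1 - x / (2 * pi))
       - 2 ^ (2 * m - 1) * hurwitz_zeta' (of_int (1 - 2 * int m)) (x / (2 * pi))
       - hurwitz_zeta' (of_int (1 - 2 * int m)) (1 - x / pi)
       + hurwitz_zeta' (of_int (1 - 2 * int m)) (x / pi)))"
proof -
  define k where "k = 2 * m - 1"
  have k: "2 * m = k + 1" using assms by (auto simp: k_def)
  have arg: "of_int (1 - 2 * int m) = (- of_nat k :: complex)"
    using k by (metis add_diff_cancel_left' diff_add_eq_diff_diff_swap minus_diff_eq of_int_minus of_int_of_nat_eq of_nat_1 of_nat_add of_nat_mult of_nat_numeral)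
  define Z where "Z b = hurwitz_zeta' (- of_nat k) b" for b
  define S where "S y n = complex_of_real (sin (real (Suc n) * y) / real (Suc n) ^ (2 * m))" for y n
  define \<gamma> where "\<gamma> = complex_of_real ((-1) ^ m * pi ^ k / fact k)"
  have S: "S y sums (\<gamma> * (2 ^ k * (Z (1 - y / (2 * pi)) - Z (y / (2 * pi)))))" if "0 < y" "y < 2 * pi" for y
  proof -
    have "(\<lambda>n. complex_of_real (sin (2 * pi * real (Suc n) * (y / (2 * pi))) / real (Suc n) ^ (2 * m))) sums
      (of_real ((-1) ^ m * (2 * pi) ^ k / fact k) * (Z (1 - y / (2 * pi)) - Z (y / (2 * pi))))"
      unfolding k_def Z_def using that assms by (intro sin_series_hurwitz_zeta') auto
    also have "(\<lambda>n. complex_of_real (sin (2 * pi * real (Suc n) * (y / (2 * pi))) / real (Suc n) ^ (2 * m))) = S y"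
      by (simp add: S_def fun_eq_iff del: of_nat_Suc)
    also have "of_real ((-1) ^ m * (2 * pi) ^ k / fact k) * (Z (1 - y / (2 * pi)) - Z (y / (2 * pi))) =
        \<gamma> * (2 ^ k * (Z (1 - y / (2 * pi)) - Z (y / (2 * pi))))"
      by (simp add: \<gamma>_def power_mult_distrib mult_ac)
    finally show ?thesis .
  qed
  \<comment> \<open>The index starts at 0, so odd n stands for the even index \<open>Suc n\<close>;
    the factor is 2^(2m).\<close>
  have even_part: "(\<lambda>n. if odd n then 2 ^ (k + 1) * S x n else 0) sums (\<gamma> * (2 ^ k * (Z (1 - x / pi) - Z (x / pi))))"
  proof -
    have "(\<lambda>n. if odd n then 2 ^ (k + 1) * S x n else 0) (2 * j + 1) = S (2 * x) j" for j
    proof -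
      have "real (Suc (2 * j + 1)) = 2 * real (Suc j)" by simp
      then show ?thesis unfolding S_def k[symmetric]
        by (simp add: power_mult_distrib mult_ac del: of_nat_Suc)
    qed
    moreover have "S (2 * x) sums (\<gamma> * (2 ^ k * (Z (1 - x / pi) - Z (x / pi))))"
      using S[of "2 * x"] assms by simp
    ultimately have "(\<lambda>j. (\<lambda>n. if odd n then 2 ^ (k + 1) * S x n else 0) (2 * j + 1)) sums
        (\<gamma> * (2 ^ k * (Z (1 - x / pi) - Z (x / pi))))" by simp
    then show ?thesis
      by (subst (asm) sums_mono_reindex[of "\<lambda>j. 2 * j + 1"]) (auto simp: strict_mono_def elim!: oddE)
  qed
  \<comment> \<open>As 2^(k+1) / 2^k = 2, the term at odd n is subtracted twice and changes its
    sign.\<close>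
  have "(\<lambda>n. S x n - 1 / 2 ^ k * (if odd n then 2 ^ (k + 1) * S x n else 0)) sums
     (\<gamma> * (2 ^ k * (Z (1 - x / (2 * pi)) - Z (x / (2 * pi)))) -
      1 / 2 ^ k * (\<gamma> * (2 ^ k * (Z (1 - x / pi) - Z (x / pi)))))"
    using S[of x] assms by (intro sums_diff sums_mult even_part) auto
  also have "(\<lambda>n. S x n - 1 / 2 ^ k * (if odd n then 2 ^ (k + 1) * S x n else 0)) =
      (\<lambda>n. complex_of_real ((-1) ^ n * sin (real (Suc n) * x) / real (Suc n) ^ (2 * m)))"
    by (rule ext) (simp add: S_def)
  also have "\<gamma> * (2 ^ k * (Z (1 - x / (2 * pi)) - Z (x / (2 * pi)))) -
      1 / 2 ^ k * (\<gamma> * (2 ^ k * (Z (1 - x / pi) - Z (x / pi)))) =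
     \<gamma> * (2 ^ k * Z (1 - x / (2 * pi)) - 2 ^ k * Z (x / (2 * pi)) - Z (1 - x / pi) + Z (x / pi))"
    by (simp add: field_simps)
  finally show ?thesis unfolding arg k_def[symmetric] \<gamma>_def Z_def .
qed

end
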